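(* Let $\phi = \forall x_1^{r_1} \cdots \forall x_k^{r_k} \exists y_1^{s_1} \cdots \exists y_l^{s_l}\, \theta$ be an $\mathcal{L}_{\mathrm{TST}}$-sentence, where superscripts denote the types of the variables, $s_1 > \cdots > s_l$, and $\theta$ is quantifier-free. Then $\mathrm{TSTI}$ decides $\phi$, i.e. $\mathrm{TSTI} \vdash \phi$ or $\mathrm{TSTI} \vdash \neg\phi$.
   Context: $\mathcal{L}_{\mathrm{TST}}$ is the many-sorted first-order language with sorts (called types) $n\in\mathbb{N}=\{0,1,2,\ldots\}$, variables $x^n,y^n,\ldots$ of each type $n$ (superscripts denote types), and a binary relation symbol $\in_n$ for each $n$. Atomic formulae have the form $x^n\in_n y^{n+1}$ or $x^n=y^n$; formulae are built with the usual connectives and quantifiers. $\mathrm{TST}$ is the $\mathcal{L}_{\mathrm{TST}}$-theory with axioms: (Extensionality) for all $n$, $\forall x^{n+1}\forall y^{n+1}(x^{n+1}=y^{n+1}\iff\forall z^n(z^n\in_n x^{n+1}\iff z^n\in_n y^{n+1}))$; (Comprehension) for all $n$ and all $\mathcal{L}_{\mathrm{TST}}$-formulae $\varphi(x^n,\vec z)$, $\forall\vec z\,\exists y^{n+1}\forall x^n(x^n\in_n y^{n+1}\iff\varphi(x^n,\vec z))$. $\mathrm{TSTI}$ is $\mathrm{TST}$ plus the axiom $\exists x^1\exists f^3(f^3:x^1\to x^1\text{ is injective but not surjective})$, where functions are sets of Wiener–Kuratowski ordered pairs (so a function between type-1 sets is an object of type 3). *)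

theory Defs
  imports Main
begin

text \<open>
  Formulae of the language of TST, with de Bruijn indices counted separately for each type:
  the variable \<open>i\<close> of type \<open>n\<close> is bound by the \<open>i\<close>-th enclosing quantifier over type \<open>n\<close>
  (counting from 0, innermost first), and quantifiers over other types do not affect it.
  \<open>Mem n i j\<close> stands for \<open>x \<in>\<^sub>n y\<close>, where \<open>x\<close> is the variable \<open>i\<close> of type \<open>n\<close> and \<open>y\<close> is the
  variable \<open>j\<close> of type \<open>n + 1\<close>; in \<open>Equ n i j\<close> both variables are of type \<open>n\<close>. Hence every term
  of type \<open>fm\<close> is well typed.
\<close>

datatype fm =
    Falsum
  | Mem nat nat nat
  | Equ nat nat nat
  | Imp fm fm
  | Forall nat fm

abbreviation Neg :: "fm \<Rightarrow> fm" where
  "Neg p \<equiv> Imp p Falsum"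

abbreviation Or :: "fm \<Rightarrow> fm \<Rightarrow> fm" where
  "Or p q \<equiv> Imp (Neg p) q"

abbreviation And :: "fm \<Rightarrow> fm \<Rightarrow> fm" where
  "And p q \<equiv> Neg (Imp p (Neg q))"

abbreviation Iff :: "fm \<Rightarrow> fm \<Rightarrow> fm" where
  "Iff p q \<equiv> And (Imp p q) (Imp q p)"

abbreviation Exists :: "nat \<Rightarrow> fm \<Rightarrow> fm" where
  "Exists n p \<equiv> Neg (Forall n (Neg p))"

abbreviation Foralls :: "nat list \<Rightarrow> fm \<Rightarrow> fm" where
  "Foralls ns p \<equiv> foldr Forall ns p"

abbreviation Existss :: "nat list \<Rightarrow> fm \<Rightarrow> fm" where
  "Existss ns p \<equiv> foldr Exists ns p"

fun qfree :: "fm \<Rightarrow> bool" where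
  "qfree Falsum = True"
| "qfree (Mem n i j) = True"
| "qfree (Equ n i j) = True"
| "qfree (Imp p q) = (qfree p \<and> qfree q)"
| "qfree (Forall n p) = False"

text \<open>Free variables, as pairs of a type and an index.\<close>

fun fv :: "fm \<Rightarrow> (nat \<times> nat) set" where
  "fv Falsum = {}"
| "fv (Mem n i j) = {(n, i), (Suc n, j)}"
| "fv (Equ n i j) = {(n, i), (n, j)}"
| "fv (Imp p q) = fv p \<union> fv q"
| "fv (Forall n p) = {(m, i). (m, if m = n then Suc i else i) \<in> fv p}"

definition sentence :: "fm \<Rightarrow> bool" where
  "sentence p \<longleftrightarrow> fv p = {}"

text \<open>
  \<open>rename r\<close> replaces each free variable \<open>i\<close> of type \<open>n\<close> by the variable \<open>r n i\<close> of type \<open>n\<close>,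
  avoiding capture. As the language has no function symbols, this covers all substitutions.
\<close>

fun rename :: "(nat \<Rightarrow> nat \<Rightarrow> nat) \<Rightarrow> fm \<Rightarrow> fm" where
  "rename r Falsum = Falsum"
| "rename r (Mem n i j) = Mem n (r n i) (r (Suc n) j)"
| "rename r (Equ n i j) = Equ n (r n i) (r n j)"
| "rename r (Imp p q) = Imp (rename r p) (rename r q)"
| "rename r (Forall n p) = Forall n (rename (r(n := case_nat 0 (\<lambda>i. Suc (r n i)))) p)"

text \<open>
  \<open>shift n p\<close> is \<open>p\<close> placed under one further quantifier over type \<open>n\<close>, whose variable does not
  occur in it; \<open>inst n t p\<close> is the instance of \<open>Forall n p\<close> at the variable \<open>t\<close> of type \<open>n\<close>.
\<close>

definition shift :: "nat \<Rightarrow> fm \<Rightarrow> fm" where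
  "shift n = rename ((\<lambda>_ i. i)(n := Suc))"

definition inst :: "nat \<Rightarrow> nat \<Rightarrow> fm \<Rightarrow> fm" where
  "inst n t = rename ((\<lambda>_ i. i)(n := case_nat t (\<lambda>i. i)))"

text \<open>
  Natural deduction for classical many-sorted logic with equality. In \<open>AllI\<close>, shifting
  the assumptions expresses the eigenvariable condition. Since variables of all types may be used
  in derivations, all types are taken to be nonempty, as usual.
\<close>

inductive derives :: "fm set \<Rightarrow> fm \<Rightarrow> bool" (infix "\<turnstile>" 50) where
  Assm: "p \<in> \<Gamma> \<Longrightarrow> \<Gamma> \<turnstile> p"
| ImpI: "insert p \<Gamma> \<turnstile> q \<Longrightarrow> \<Gamma> \<turnstile> Imp p q"
| ImpE: "\<Gamma> \<turnstile> Imp p q \<Longrightarrow> \<Gamma> \<turnstile> p \<Longrightarrow> \<Gamma> \<turnstile> q"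
| Contr: "insert (Neg p) \<Gamma> \<turnstile> Falsum \<Longrightarrow> \<Gamma> \<turnstile> p"
| AllI: "shift n ` \<Gamma> \<turnstile> p \<Longrightarrow> \<Gamma> \<turnstile> Forall n p"
| AllE: "\<Gamma> \<turnstile> Forall n p \<Longrightarrow> \<Gamma> \<turnstile> inst n t p"
| EquI: "\<Gamma> \<turnstile> Equ n i i"
| EquE: "\<Gamma> \<turnstile> Equ n i j \<Longrightarrow> \<Gamma> \<turnstile> inst n i p \<Longrightarrow> \<Gamma> \<turnstile> inst n j p"

definition decides :: "fm set \<Rightarrow> fm \<Rightarrow> bool" where
  "decides T p \<longleftrightarrow> T \<turnstile> p \<or> T \<turnstile> Neg p"

definition extensionality :: "nat \<Rightarrow> fm" where
  "extensionality n =
     Forall (Suc n) (Forall (Suc n)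
       (Iff (Equ (Suc n) 1 0) (Forall n (Iff (Mem n 0 1) (Mem n 0 0)))))"

text \<open>
  In \<open>p\<close>, the variable 0 of type \<open>n\<close> is the \<open>x\<close> of the comprehension scheme; all other free variables
  of \<open>p\<close> are parameters. The set \<open>y\<close> is the variable 0 of type \<open>n + 1\<close>, and shifting keeps it from
  occurring in \<open>p\<close>.
\<close>

definition comprehension :: "nat \<Rightarrow> fm \<Rightarrow> fm" where
  "comprehension n p = Exists (Suc n) (Forall n (Iff (Mem n 0 0) (shift (Suc n) p)))"

definition TST :: "fm set" where
  "TST = range extensionality \<union>
     {Foralls ts (comprehension n p) | ts n p. sentence (Foralls ts (comprehension n p))}"

text \<open>
  \<open>is_upair n w u v\<close>: the variable \<open>w\<close> of type \<open>n + 1\<close> is the unordered pair of the variables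
  \<open>u\<close> and \<open>v\<close> of type \<open>n\<close>. \<open>is_pair n z u v\<close>: the variable \<open>z\<close> of type \<open>n + 2\<close> is the
  Wiener--Kuratowski pair \<open>{{u}, {u, v}}\<close>. \<open>pair_in n f u v\<close>: this pair belongs to the variable
  \<open>f\<close> of type \<open>n + 3\<close>.
\<close>

definition is_upair :: "nat \<Rightarrow> nat \<Rightarrow> nat \<Rightarrow> nat \<Rightarrow> fm" where
  "is_upair n w u v =
     Forall n (Iff (Mem n 0 w) (Or (Equ n 0 (Suc u)) (Equ n 0 (Suc v))))"

definition is_pair :: "nat \<Rightarrow> nat \<Rightarrow> nat \<Rightarrow> nat \<Rightarrow> fm" where
  "is_pair n z u v =
     Forall (n + 1) (Iff (Mem (n + 1) 0 z) (Or (is_upair n 0 u u) (is_upair n 0 u v)))"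

definition pair_in :: "nat \<Rightarrow> nat \<Rightarrow> nat \<Rightarrow> nat \<Rightarrow> fm" where
  "pair_in n f u v = Exists (n + 2) (And (Mem (n + 2) 0 f) (is_pair n 0 u v))"

text \<open>
  In the following three formulae the free variables are the variable 0 of type 1, for the set \<open>x\<close>,
  and the variable 0 of type 3, for \<open>f\<close>.
\<close>

definition is_function :: fm where
  "is_function = And
     (Forall 2 (Imp (Mem 2 0 0)
       (Exists 0 (Exists 0 (And (And (Mem 0 1 0) (Mem 0 0 0)) (is_pair 0 0 1 0))))))
     (And
       (Forall 0 (Imp (Mem 0 0 0) (Exists 0 (pair_in 0 0 1 0))))
       (Forall 0 (Forall 0 (Forall 0
         (Imp (And (pair_in 0 0 2 1) (pair_in 0 0 2 0)) (Equ 0 1 0))))))"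

definition is_injective :: fm where
  "is_injective = Forall 0 (Forall 0 (Forall 0
     (Imp (And (pair_in 0 0 2 0) (pair_in 0 0 1 0)) (Equ 0 2 1))))"

definition is_surjective :: fm where
  "is_surjective = Forall 0 (Imp (Mem 0 0 0) (Exists 0 (pair_in 0 0 0 1)))"

definition infinity :: fm where
  "infinity = Exists 1 (Exists 3 (And is_function (And is_injective (Neg is_surjective))))"

definition TSTI :: "fm set" where
  "TSTI = insert infinity TST"

end

theory Submission
  imports Defs "HOL-Library.Countable"
begin

text \<open>
  If TSTI did not decide \<open>\<phi>\<close>, then by completeness (\<open>model_existence\<close>) there would be a model \<open>M\<close> of TSTI in which
  \<open>\<phi>\<close> fails and a model \<open>N\<close> in which it holds. In \<open>M\<close> there are values \<open>a\<close> of the universally quantified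
  variables for which no values of the existentially quantified ones satisfy \<open>\<theta>\<close>. It suffices to find values \<open>b\<close> in \<open>N\<close>
  with the following property: for all elements \<open>c\<close> of \<open>N\<close>, one of each type, there are elements \<open>d\<close> of \<open>M\<close>
  such that \<open>a, d\<close> and \<open>b, c\<close> satisfy the same atomic formulae (\<open>realise_over_copy\<close>). Then \<open>b\<close> refutes \<open>\<phi>\<close> in \<open>N\<close>.

  The elements \<open>d\<close> are found by means of colours. The colour of an element \<open>x\<close> of type \<open>n\<close> relative to \<open>a\<close>
  records which of the parameters of type \<open>n + 1\<close> contain \<open>x\<close> and, if \<open>n > 0\<close>, which colours occur among the members of
  \<open>x\<close> and which among the nonmembers; if \<open>n = 0\<close>, it records which parameters are equal to \<open>x\<close>. There are finitely many
  colours of each type, and the colour of \<open>x\<close> determines all atomic facts about \<open>x\<close> and the parameters.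
  Suppose that the same colours occur in \<open>M\<close> and in \<open>N\<close>. Since the \<open>c\<close> have distinct types, the only memberships between
  them are those of \<open>c n\<close> in \<open>c (n + 1)\<close>, and \<open>d\<close> can be chosen from the highest type downwards: if \<open>d (n + 1)\<close> has the
  colour of \<open>c (n + 1)\<close>, then it has members, respectively nonmembers, of the colour of \<open>c n\<close> whenever
  \<open>c (n + 1)\<close> has. This is where the hypothesis on the types of the existential quantifiers enters.

  It remains to choose \<open>b\<close> such that the same colours occur (\<open>copy_parameters\<close>). This goes from type 0 upwards, with a
  stronger invariant: each colour has equally many elements in \<open>M\<close> and in \<open>N\<close>, or at least \<open>t\<close> in both, for a
  threshold \<open>t\<close> that may be prescribed arbitrarily. At type 0 the invariant can be achieved because
  both models are infinite. If it holds at type \<open>n\<close> with the threshold \<open>2 ^ t\<close>, then the number of sets of type \<open>n + 1\<close>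
  with prescribed colours of members and of nonmembers is the same in both models up to \<open>t\<close>, because any \<open>t\<close> sets cut a
  colour class into at most \<open>2 ^ t\<close> pieces, and such a cutting can be imitated in the other model
  (\<open>same_card_upto_refine\<close>). The same imitation copies the way in which the parameters of type \<open>n + 2\<close> divide the
  elements of type \<open>n + 1\<close>. The pieces can be chosen finite or cofinite in a colour class; hence they are sets in the
  sense of \<open>N\<close>, and unions of them serve as the parameters in \<open>N\<close>.
\<close>

section \<open>Renaming and derivations\<close>

lemma rename_cong:
  "(\<And>n i. (n, i) \<in> fv p \<Longrightarrow> r n i = s n i) \<Longrightarrow> rename r p = rename s p"
proof (induction p arbitrary: r s)
  case (Forall n p)
  have "rename (r(n := case_nat 0 (\<lambda>i. Suc (r n i)))) p = rename (s(n := case_nat 0 (\<lambda>i. Suc (s n i)))) p"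
  proof (rule Forall.IH)
    fix k i assume k: "(k, i) \<in> fv p"
    show "(r(n := case_nat 0 (\<lambda>i. Suc (r n i)))) k i = (s(n := case_nat 0 (\<lambda>i. Suc (s n i)))) k i"
      \<comment> \<open>\<open>i - 1\<close> is the index of the variable outside the quantifier; for \<open>i = 0\<close> both sides are 0.\<close>
      using Forall.prems[of k "if k = n then i - 1 else i"] k by (auto split: nat.split)
  qed
  then show ?case by simp
next
  case (Imp p q)
  then show ?case by (metis UnCI fv.simps(4) rename.simps(4))
qed simp_all

lemma rename_rename: "rename r (rename s p) = rename (\<lambda>n i. r n (s n i)) p"
proof (induction p arbitrary: r s)
  case (Forall n p)
  have "(\<lambda>k i. (r(n := case_nat 0 (\<lambda>i. Suc (r n i)))) k ((s(n := case_nat 0 (\<lambda>i. Suc (s n i)))) k i))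
      = (\<lambda>k i. r k (s k i))(n := case_nat 0 (\<lambda>i. Suc (r n (s n i))))"
    by (auto simp: fun_eq_iff split: nat.split)
  then show ?case by (simp add: Forall.IH)
qed auto

lemma rename_id: "rename (\<lambda>n i. i) p = p"
proof (induction p)
  case (Forall n p)
  have "(\<lambda>n i. i)(n := case_nat 0 (\<lambda>i. Suc i)) = (\<lambda>n i. i)"
    by (auto simp: fun_eq_iff split: nat.split)
  then show ?case by (simp only: rename.simps Forall.IH)
qed auto

lemma rename_inst:
  "rename r (inst n t p) = inst n (r n t) (rename (r(n := case_nat 0 (\<lambda>i. Suc (r n i)))) p)"
  unfolding inst_def rename_rename
  by (rule rename_cong) (auto split: nat.split)

lemma rename_shift:
  "rename (r(n := case_nat 0 (\<lambda>i. Suc (r n i)))) (shift n p) = shift n (rename r p)"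
  unfolding shift_def rename_rename by (rule rename_cong) auto

lemma inst_rename_lift:
  "inst n t (rename (r(n := case_nat 0 (\<lambda>i. Suc (r n i)))) p) = rename (r(n := case_nat t (r n))) p"
  unfolding inst_def rename_rename by (rule rename_cong) (auto split: nat.split)

lemma derives_mono: "\<Gamma> \<turnstile> p \<Longrightarrow> \<Gamma> \<subseteq> \<Delta> \<Longrightarrow> \<Delta> \<turnstile> p"
proof (induction arbitrary: \<Delta> rule: derives.induct)
  case (ImpI p \<Gamma> q) then show ?case by (meson derives.ImpI insert_mono)
next
  case (Contr p \<Gamma>) then show ?case by (meson derives.Contr insert_mono)
next
  case (AllI n \<Gamma> p) then show ?case by (meson derives.AllI image_mono)
next
  case (Assm p \<Gamma>) then show ?case by (meson derives.Assm subsetD)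
next
  case (ImpE \<Gamma> p q) then show ?case by (meson derives.ImpE)
next
  case (AllE \<Gamma> n p t) then show ?case by (meson derives.AllE)
next
  case (EquI \<Gamma> n i) show ?case by (rule derives.EquI)
next
  case (EquE \<Gamma> n i j p) then show ?case by (meson derives.EquE)
qed

text \<open>
  In the case of \<open>AllI\<close> the induction hypothesis is needed for the renaming lifted under the
  quantifier, so the renaming is kept arbitrary.
\<close>

lemma derives_rename: "\<Gamma> \<turnstile> p \<Longrightarrow> rename r ` \<Gamma> \<turnstile> rename r p"
proof (induction arbitrary: r rule: derives.induct)
  case (AllI n \<Gamma> p)
  let ?r = "r(n := case_nat 0 (\<lambda>i. Suc (r n i)))"
  have "rename ?r ` shift n ` \<Gamma> = shift n ` rename r ` \<Gamma>"
    by (simp only: image_image rename_shift)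
  with AllI.IH[of ?r] show ?case unfolding rename.simps by (metis derives.AllI)
next
  case (AllE \<Gamma> n p t)
  then show ?case by (metis rename_inst rename.simps(5) derives.AllE)
next
  case (EquE \<Gamma> n i j p)
  then show ?case by (metis rename_inst rename.simps(3) derives.EquE)
next
  case (ImpE \<Gamma> p q) then show ?case by (metis rename.simps(4) derives.ImpE)
next
  case (Assm p \<Gamma>) then show ?case by (simp add: derives.Assm)
next
  case (ImpI p \<Gamma> q) then show ?case by (simp add: derives.ImpI)
next
  case (Contr p \<Gamma>) then show ?case by (simp add: derives.Contr)
next
  case (EquI \<Gamma> n i) show ?case by (simp add: derives.EquI)
qed

lemma derives_finite: "\<Gamma> \<turnstile> p \<Longrightarrow> \<exists>\<Gamma>'\<subseteq>\<Gamma>. finite \<Gamma>' \<and> \<Gamma>' \<turnstile> p"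
proof (induction rule: derives.induct)
  case (Assm p \<Gamma>)
  then show ?case by (intro exI[of _ "{p}"]) (auto intro: derives.intros)
next
  case (ImpI p \<Gamma> q)
  then obtain D where "D \<subseteq> insert p \<Gamma>" "finite D" "D \<turnstile> q" by auto
  then have "D - {p} \<subseteq> \<Gamma>" "finite (D - {p})" "D - {p} \<turnstile> Imp p q"
    by (auto intro!: derives.ImpI elim: derives_mono)
  then show ?case by blast
next
  case (ImpE \<Gamma> p q)
  then obtain D D' where "D \<subseteq> \<Gamma>" "finite D" "D \<turnstile> Imp p q" "D' \<subseteq> \<Gamma>" "finite D'" "D' \<turnstile> p" by auto
  then have "D \<union> D' \<subseteq> \<Gamma>" "finite (D \<union> D')" "D \<union> D' \<turnstile> q"
    by (auto intro!: derives.ImpE[of "D \<union> D'" p q] elim: derives_mono)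
  then show ?case by blast
next
  case (Contr p \<Gamma>)
  then obtain D where "D \<subseteq> insert (Neg p) \<Gamma>" "finite D" "D \<turnstile> Falsum" by auto
  moreover from \<open>D \<turnstile> Falsum\<close> have "insert (Neg p) (D - {Neg p}) \<turnstile> Falsum"
    by (rule derives_mono) auto
  then have "D - {Neg p} \<turnstile> p" by (rule derives.Contr)
  ultimately show ?case by (intro exI[of _ "D - {Neg p}"]) auto
next
  case (AllI n \<Gamma> p)
  then obtain D where D: "D \<subseteq> shift n ` \<Gamma>" "finite D" "D \<turnstile> p" by auto
  then obtain C where "C \<subseteq> \<Gamma>" "finite C" "D = shift n ` C" by (meson finite_subset_image)
  with D show ?case by (meson derives.AllI)
next
  case (EquE \<Gamma> n i j p)
  then obtain D D' where "D \<subseteq> \<Gamma>" "finite D" "D \<turnstile> Equ n i j" "D' \<subseteq> \<Gamma>" "finite D'" "D' \<turnstile> inst n i p"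
    by auto
  then have "D \<union> D' \<subseteq> \<Gamma>" "finite (D \<union> D')" "D \<union> D' \<turnstile> inst n j p"
    by (auto intro!: derives.EquE[of "D \<union> D'" n i j p] elim: derives_mono)
  then show ?case by blast
next
  case (AllE \<Gamma> n p t) then show ?case by (meson derives.AllE)
next
  case (EquI \<Gamma> n i) show ?case by (meson derives.EquI empty_subsetI finite.emptyI)
qed

text \<open>
  Generalisation in terms of an eigenvariable. The renaming in the proof sends the fresh variable \<open>t\<close> to 0 and
  moves all other variables of type \<open>n\<close> up by one: this is \<open>shift\<close> on formulae without \<open>t\<close>, and
  it undoes the instantiation of \<open>p\<close> by \<open>t\<close>, so \<open>AllI\<close> applies to the renamed derivation.
\<close>

lemma derives_Forall_fresh:
  assumes "\<Gamma> \<turnstile> inst n t p" and "\<And>q. q \<in> \<Gamma> \<Longrightarrow> (n, t) \<notin> fv q" and "(n, t) \<notin> fv (Forall n p)"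
  shows "\<Gamma> \<turnstile> Forall n p"
proof (rule derives.AllI)
  define r where "r = (\<lambda>k i. if k = n then if i = t then 0 else Suc i else (i :: nat))"
  have "rename r q = shift n q" if "q \<in> \<Gamma>" for q
    unfolding shift_def using assms(2)[OF that] by (intro rename_cong) (auto simp: r_def)
  then have "rename r ` \<Gamma> = shift n ` \<Gamma>" by (auto simp: image_iff)
  moreover have "rename r (inst n t p) = rename (\<lambda>k i. i) p"
    unfolding inst_def rename_rename using assms(3)
    by (intro rename_cong) (auto simp: r_def split: nat.split)
  ultimately show "shift n ` \<Gamma> \<turnstile> p"
    using derives_rename[OF assms(1), of r] by (simp add: rename_id)
qed

lemma finite_fv: "finite (fv p)"
proof (induction p)
  case (Forall n p)
  have "fv (Forall n p) \<subseteq> (\<lambda>(m, i). (m, if m = n then i - 1 else i)) ` fv p"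
    by (force simp: image_iff split: if_splits)
  then show ?case using Forall finite_surj by blast
qed auto

section \<open>Completeness\<close>

instance fm :: countable by countable_datatype

text \<open>
  Henkin's construction with the variables themselves as witnesses. Infinitely many variables of each type
  remain unused as long as one starts from sentences and adds finitely many formulae.
\<close>

definition witness :: "fm set \<Rightarrow> fm \<Rightarrow> fm set" where
  "witness \<Gamma> p = (case p of
     Imp (Forall n q) Falsum \<Rightarrow>
       {Neg (inst n (SOME t. \<forall>r\<in>insert p \<Gamma>. (n, t) \<notin> fv r) q)}
   | _ \<Rightarrow> {})"

lemma fresh_variable:
  assumes "finite (\<Union>(fv ` \<Gamma>))"
  shows "\<exists>t. \<forall>r\<in>\<Gamma>. (n, t) \<notin> fv r"
proof -
  have "finite (snd ` \<Union>(fv ` \<Gamma>))" using assms by simp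
  then obtain t where "t \<notin> snd ` \<Union>(fv ` \<Gamma>)" using ex_new_if_finite infinite_UNIV_nat by blast
  then show ?thesis by (intro exI[of _ t]) (force simp: image_iff)
qed

lemma consistent_witness:
  assumes "finite (\<Union>(fv ` \<Gamma>))" and con: "\<not> insert p \<Gamma> \<turnstile> Falsum"
  shows "\<not> witness \<Gamma> p \<union> insert p \<Gamma> \<turnstile> Falsum"
proof (cases "\<exists>n q. p = Neg (Forall n q)")
  case True
  then obtain n q where p: "p = Neg (Forall n q)" by auto
  define t where "t = (SOME t. \<forall>r\<in>insert p \<Gamma>. (n, t) \<notin> fv r)"
  have "finite (\<Union>(fv ` insert p \<Gamma>))" using assms(1) finite_fv by simp
  then have t: "\<forall>r\<in>insert p \<Gamma>. (n, t) \<notin> fv r"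
    unfolding t_def by (rule someI_ex[OF fresh_variable])
  show ?thesis
  proof
    assume "witness \<Gamma> p \<union> insert p \<Gamma> \<turnstile> Falsum"
    moreover have "witness \<Gamma> p = {Neg (inst n t q)}"
      unfolding witness_def t_def p by simp
    ultimately have "insert p \<Gamma> \<turnstile> inst n t q" by (metis derives.Contr insert_is_Un)
    then have "insert p \<Gamma> \<turnstile> Forall n q"
      using t p by (intro derives_Forall_fresh[where t = t]) auto
    with con show False using p by (meson derives.Assm derives.ImpE insertI1)
  qed
next
  case False
  then have "witness \<Gamma> p = {}" by (auto simp: witness_def split: fm.split)
  with con show ?thesis by simp
qed

text \<open>
  The formulae are enumerated by \<open>from_nat\<close>. A formula is accepted together with its witness if it is
  consistent with those accepted before.
\<close>

primrec stage :: "fm set \<Rightarrow> nat \<Rightarrow> fm set" where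
  "stage \<Gamma> 0 = \<Gamma>"
| "stage \<Gamma> (Suc k) =
    (let p = from_nat k in
     if insert p (stage \<Gamma> k) \<turnstile> Falsum then stage \<Gamma> k
     else witness (stage \<Gamma> k) p \<union> insert p (stage \<Gamma> k))"

definition henkin :: "fm set \<Rightarrow> fm set" where
  "henkin \<Gamma> = (\<Union>k. stage \<Gamma> k)"

lemma stage_mono: "k \<le> l \<Longrightarrow> stage \<Gamma> k \<subseteq> stage \<Gamma> l"
  by (rule lift_Suc_mono_le[of "stage \<Gamma>"]) (auto simp: Let_def)

lemma finite_witness: "finite (witness \<Gamma> p)"
  by (auto simp: witness_def split: fm.split)

locale consistent_sentences =
  fixes \<Gamma> :: "fm set"
  assumes sentences: "p \<in> \<Gamma> \<Longrightarrow> sentence p"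
    and consistent: "\<not> \<Gamma> \<turnstile> Falsum"
begin

lemma finite_fv_stage: "finite (\<Union>(fv ` stage \<Gamma> k))"
proof (induction k)
  case 0
  have "\<Union>(fv ` stage \<Gamma> 0) = {}" using sentences by (auto simp: sentence_def)
  then show ?case by simp
next
  case (Suc k)
  then show ?case using finite_fv finite_witness by (auto simp: Let_def)
qed

lemma consistent_stage: "\<not> stage \<Gamma> k \<turnstile> Falsum"
proof (induction k)
  case (Suc k)
  then show ?case using consistent_witness[OF finite_fv_stage] by (auto simp: Let_def)
qed (simp add: consistent)

abbreviation "\<Delta> \<equiv> henkin \<Gamma>"

lemma consistent_henkin: "\<not> \<Delta> \<turnstile> Falsum"
proof
  assume "\<Delta> \<turnstile> Falsum"
  then obtain D where D: "D \<subseteq> \<Delta>" "finite D" "D \<turnstile> Falsum" using derives_finite by blast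
  have "\<exists>k. D \<subseteq> stage \<Gamma> k" using D(2,1)
  proof (induction D)
    case (insert p D)
    then obtain k l where "D \<subseteq> stage \<Gamma> k" "p \<in> stage \<Gamma> l" by (auto simp: henkin_def)
    then have "insert p D \<subseteq> stage \<Gamma> (max k l)"
      using stage_mono[of k "max k l" \<Gamma>] stage_mono[of l "max k l" \<Gamma>] by auto
    then show ?case by blast
  qed simp
  then obtain k where "D \<subseteq> stage \<Gamma> k" ..
  with D(3) have "stage \<Gamma> k \<turnstile> Falsum" by (rule derives_mono)
  with consistent_stage show False by blast
qed

lemma stage_in_henkin: "stage \<Gamma> k \<subseteq> \<Delta>" by (auto simp: henkin_def)

text \<open>
  Acceptance is decided at the stage with number \<open>to_nat p\<close>; this gives both the maximality of the
  limit and its Henkin property.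
\<close>

lemma henkin_decides_step:
  "p \<in> \<Delta> \<and> witness (stage \<Gamma> (to_nat p)) p \<subseteq> \<Delta> \<or> insert p \<Delta> \<turnstile> Falsum"
proof (cases "insert p (stage \<Gamma> (to_nat p)) \<turnstile> Falsum")
  case True
  then have "insert p \<Delta> \<turnstile> Falsum"
    by (rule derives_mono) (rule insert_mono[OF stage_in_henkin])
  then show ?thesis ..
next
  case False
  then show ?thesis using stage_in_henkin[of "Suc (to_nat p)"] by (auto simp: Let_def)
qed

lemma henkin_derives: "\<Delta> \<turnstile> p \<longleftrightarrow> p \<in> \<Delta>"
proof
  assume p: "\<Delta> \<turnstile> p"
  show "p \<in> \<Delta>"
  proof (rule ccontr)
    assume "p \<notin> \<Delta>"
    with henkin_decides_step[of p] have "\<Delta> \<turnstile> Neg p" by (metis derives.ImpI)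
    with p consistent_henkin show False by (metis derives.ImpE)
  qed
qed (rule derives.Assm)

lemma henkin_Falsum: "Falsum \<notin> \<Delta>"
  using consistent_henkin henkin_derives by blast

lemma henkin_Neg: "Neg p \<in> \<Delta> \<longleftrightarrow> p \<notin> \<Delta>"
proof
  assume "Neg p \<in> \<Delta>" then show "p \<notin> \<Delta>"
    by (metis henkin_derives derives.ImpE henkin_Falsum)
next
  assume "p \<notin> \<Delta>" then show "Neg p \<in> \<Delta>"
    using henkin_decides_step[of p] by (metis henkin_derives derives.ImpI)
qed

lemma henkin_Imp: "Imp p q \<in> \<Delta> \<longleftrightarrow> (p \<in> \<Delta> \<longrightarrow> q \<in> \<Delta>)"
proof
  assume "Imp p q \<in> \<Delta>" then show "p \<in> \<Delta> \<longrightarrow> q \<in> \<Delta>" by (metis henkin_derives derives.ImpE)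
next
  assume a: "p \<in> \<Delta> \<longrightarrow> q \<in> \<Delta>"
  have "insert p \<Delta> \<turnstile> q"
  proof (cases "p \<in> \<Delta>")
    case True with a show ?thesis by (auto intro: derives.Assm)
  next
    case False
    then have "Neg p \<in> \<Delta>" by (simp add: henkin_Neg)
    then have "insert (Neg q) (insert p \<Delta>) \<turnstile> Falsum"
      by (meson derives.Assm derives.ImpE insertCI)
    then show ?thesis by (rule derives.Contr)
  qed
  then show "Imp p q \<in> \<Delta>" by (metis henkin_derives derives.ImpI)
qed

lemma henkin_Forall: "Forall n p \<in> \<Delta> \<longleftrightarrow> (\<forall>t. inst n t p \<in> \<Delta>)"
proof
  assume "Forall n p \<in> \<Delta>" then show "\<forall>t. inst n t p \<in> \<Delta>" by (metis henkin_derives derives.AllE)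
next
  assume a: "\<forall>t. inst n t p \<in> \<Delta>"
  show "Forall n p \<in> \<Delta>"
  proof (rule ccontr)
    assume "Forall n p \<notin> \<Delta>"
    then have N: "Neg (Forall n p) \<in> \<Delta>" by (simp add: henkin_Neg)
    then have "\<not> insert (Neg (Forall n p)) \<Delta> \<turnstile> Falsum"
      using consistent_henkin by (simp add: insert_absorb)
    then have "witness (stage \<Gamma> (to_nat (Neg (Forall n p)))) (Neg (Forall n p)) \<subseteq> \<Delta>"
      using henkin_decides_step by blast
    then obtain t where "Neg (inst n t p) \<in> \<Delta>" by (auto simp: witness_def)
    with a show False by (simp add: henkin_Neg)
  qed
qed

lemma henkin_EquI: "Equ n i i \<in> \<Delta>"
  by (metis henkin_derives derives.EquI)

lemma henkin_EquE: "Equ n i j \<in> \<Delta> \<Longrightarrow> inst n i p \<in> \<Delta> \<Longrightarrow> inst n j p \<in> \<Delta>"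
  by (metis henkin_derives derives.EquE)

lemma henkin_Equ_sym: "Equ n i j \<in> \<Delta> \<Longrightarrow> Equ n j i \<in> \<Delta>"
  using henkin_EquE[of n i j "Equ n 0 (Suc i)"] henkin_EquI by (simp add: inst_def)

lemma henkin_Equ_trans: "Equ n i j \<in> \<Delta> \<Longrightarrow> Equ n j k \<in> \<Delta> \<Longrightarrow> Equ n i k \<in> \<Delta>"
  using henkin_EquE[of n j k "Equ n (Suc i) 0"] by (simp add: inst_def)

lemma henkin_Mem_cong:
  assumes "Equ n i i' \<in> \<Delta>" "Equ (Suc n) j j' \<in> \<Delta>"
  shows "Mem n i j \<in> \<Delta> \<longleftrightarrow> Mem n i' j' \<in> \<Delta>"
proof -
  have "Mem n i' j \<in> \<Delta>" if "Equ n i i' \<in> \<Delta>" "Mem n i j \<in> \<Delta>" for i i' j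
    using henkin_EquE[of n i i' "Mem n 0 j"] that by (simp add: inst_def)
  moreover have "Mem n i j' \<in> \<Delta>" if "Equ (Suc n) j j' \<in> \<Delta>" "Mem n i j \<in> \<Delta>" for i j j'
    using henkin_EquE[of "Suc n" j j' "Mem n i 0"] that by (simp add: inst_def)
  ultimately show ?thesis using assms henkin_Equ_sym by blast
qed

text \<open>
  The least member represents the class of a variable modulo provable equality. Taking
  representatives as the elements makes equality in the term model the identity.
\<close>

definition rep :: "nat \<Rightarrow> nat \<Rightarrow> nat" where
  "rep n i = (LEAST j. Equ n i j \<in> \<Delta>)"

lemma Equ_rep: "Equ n i (rep n i) \<in> \<Delta>"
  unfolding rep_def by (rule LeastI[of _ i]) (rule henkin_EquI)

lemma rep_eq: "rep n i = rep n j \<longleftrightarrow> Equ n i j \<in> \<Delta>"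
proof
  assume "rep n i = rep n j" then show "Equ n i j \<in> \<Delta>"
    by (metis Equ_rep henkin_Equ_sym henkin_Equ_trans)
next
  assume "Equ n i j \<in> \<Delta>"
  then have "Equ n i k \<in> \<Delta> \<longleftrightarrow> Equ n j k \<in> \<Delta>" for k
    by (metis henkin_Equ_sym henkin_Equ_trans)
  then show "rep n i = rep n j" by (simp add: rep_def)
qed

end

text \<open>
  A structure is given by the domain \<open>U n\<close> of each type and the extension \<open>X n y\<close> of each \<open>y\<close> of type
  \<open>n + 1\<close>, that is, the set of the elements of type \<open>n\<close> which belong to \<open>y\<close>.
\<close>

fun sat :: "(nat \<Rightarrow> 'u set) \<Rightarrow> (nat \<Rightarrow> 'u \<Rightarrow> 'u set) \<Rightarrow> (nat \<Rightarrow> nat \<Rightarrow> 'u) \<Rightarrow> fm \<Rightarrow> bool" where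
  "sat U X e Falsum = False"
| "sat U X e (Mem n i j) = (e n i \<in> X n (e (Suc n) j))"
| "sat U X e (Equ n i j) = (e n i = e n j)"
| "sat U X e (Imp p q) = (sat U X e p \<longrightarrow> sat U X e q)"
| "sat U X e (Forall n p) = (\<forall>x\<in>U n. sat U X (e(n := case_nat x (e n))) p)"

definition valuation :: "(nat \<Rightarrow> 'u set) \<Rightarrow> (nat \<Rightarrow> nat \<Rightarrow> 'u) \<Rightarrow> bool" where
  "valuation U e \<longleftrightarrow> (\<forall>n i. e n i \<in> U n)"

context consistent_sentences
begin

text \<open>
  The renaming \<open>r\<close> is general because instantiating a quantified variable in the term model amounts
  to extending the renaming.
\<close>

lemma truth:
  "sat (\<lambda>n. range (rep n)) (\<lambda>n y. {x \<in> range (rep n). Mem n x y \<in> \<Delta>}) (\<lambda>n i. rep n (r n i)) p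
     \<longleftrightarrow> rename r p \<in> \<Delta>"
proof (induction p arbitrary: r)
  case (Mem n i j)
  show ?case using henkin_Mem_cong[OF Equ_rep Equ_rep] by simp
next
  case (Forall n p)
  let ?S = "sat (\<lambda>n. range (rep n)) (\<lambda>n y. {x \<in> range (rep n). Mem n x y \<in> \<Delta>})"
  have "(\<lambda>n i. rep n (r n i))(n := case_nat (rep n t) (\<lambda>i. rep n (r n i)))
      = (\<lambda>k i. rep k ((r(n := case_nat t (r n))) k i))" for t
    by (auto simp: fun_eq_iff split: nat.split)
  then have "?S (\<lambda>n i. rep n (r n i)) (Forall n p)
      \<longleftrightarrow> (\<forall>t. rename (r(n := case_nat t (r n))) p \<in> \<Delta>)"
    by (simp only: sat.simps Forall.IH ball_simps)
  then show ?case by (simp add: henkin_Forall inst_rename_lift)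
qed (auto simp: henkin_Falsum henkin_Imp rep_eq)

end

theorem model_existence:
  assumes "\<And>p. p \<in> \<Gamma> \<Longrightarrow> sentence p" and "\<not> \<Gamma> \<turnstile> Falsum"
  obtains U :: "nat \<Rightarrow> nat set" and X e
  where "\<And>n y. X n y \<subseteq> U n" "valuation U e" "\<And>p. p \<in> \<Gamma> \<Longrightarrow> sat U X e p"
proof -
  interpret consistent_sentences \<Gamma> using assms by unfold_locales
  have "sat (\<lambda>n. range (rep n)) (\<lambda>n y. {x \<in> range (rep n). Mem n x y \<in> \<Delta>}) rep p" if "p \<in> \<Gamma>" for p
    using truth[of "\<lambda>n i. i" p] stage_in_henkin[of 0] that by (auto simp: rename_id)
  then show thesis by (intro that[of "\<lambda>n y. {x \<in> range (rep n). Mem n x y \<in> \<Delta>}" "\<lambda>n. range (rep n)" rep])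
      (auto simp: valuation_def)
qed

section \<open>Cardinality up to a threshold\<close>

definition at_least :: "nat \<Rightarrow> 'a set \<Rightarrow> bool" where
  "at_least q A \<longleftrightarrow> infinite A \<or> q \<le> card A"

text \<open>
  The cardinalities are equal, or both are at least \<open>t\<close>. This is the amount of information on
  the size of a set that survives in a different structure.
\<close>

definition same_card_upto :: "nat \<Rightarrow> 'a set \<Rightarrow> 'b set \<Rightarrow> bool" where
  "same_card_upto t A B \<longleftrightarrow> (\<forall>q\<le>t. at_least q A \<longleftrightarrow> at_least q B)"

lemma at_least_obtain:
  assumes "at_least q A"
  obtains F where "F \<subseteq> A" "finite F" "card F = q"
  using assms infinite_arbitrarily_large[of A q] obtain_subset_with_card_n[of q A]
  unfolding at_least_def by metis

lemma at_least_superset: "finite F \<Longrightarrow> F \<subseteq> A \<Longrightarrow> at_least (card F) A"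
  by (auto simp: at_least_def card_mono)

lemma at_least_1: "at_least (Suc 0) A \<longleftrightarrow> A \<noteq> {}"
  by (auto simp: at_least_def Suc_le_eq card_gt_0_iff)

lemma same_card_upto_mono: "same_card_upto t A B \<Longrightarrow> s \<le> t \<Longrightarrow> same_card_upto s A B"
  by (auto simp: same_card_upto_def)

lemma same_card_upto_sym: "same_card_upto t A B \<Longrightarrow> same_card_upto t B A"
  by (auto simp: same_card_upto_def)

lemma same_card_upto_empty: "same_card_upto t A B \<Longrightarrow> 1 \<le> t \<Longrightarrow> A = {} \<longleftrightarrow> B = {}"
  unfolding same_card_upto_def by (metis One_nat_def at_least_1)

lemma same_card_upto_at_least: "at_least t A \<Longrightarrow> at_least t B \<Longrightarrow> same_card_upto t A B"
  by (auto simp: same_card_upto_def at_least_def)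

lemma same_card_upto_card: "finite A \<Longrightarrow> finite B \<Longrightarrow> card A = card B \<Longrightarrow> same_card_upto t A B"
  by (auto simp: same_card_upto_def at_least_def)

lemma same_card_upto_small:
  assumes "same_card_upto t A B" "\<not> at_least t A"
  shows "finite A" "finite B" "card B = card A" "card A < t"
proof -
  have "\<not> at_least t B" using assms by (auto simp: same_card_upto_def)
  with assms(2) show "finite A" "finite B" "card A < t" by (auto simp: at_least_def)
  have "card B < t" using \<open>\<not> at_least t B\<close> by (auto simp: at_least_def)
  with \<open>card A < t\<close> assms(1) have "at_least (card A) B" "at_least (card B) A"
    using at_least_def by (metis (no_types) same_card_upto_def less_imp_le order_refl)+
  then show "card B = card A" using \<open>finite A\<close> \<open>finite B\<close> by (auto simp: at_least_def)
qed

lemma at_least_Un_disjoint: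
  "at_least p A \<Longrightarrow> at_least q B \<Longrightarrow> A \<inter> B = {} \<Longrightarrow> at_least (p + q) (A \<union> B)"
  by (auto simp: at_least_def card_Un_disjoint)

lemma at_least_Diff:
  assumes "at_least (p + q) A" "finite F" "card F = p" "F \<subseteq> A"
  shows "at_least q (A - F)"
  using assms by (auto simp: at_least_def card_Diff_subset)

text \<open>
  If \<open>A\<close> has fewer than \<open>t\<close> elements, \<open>C\<close> takes as many from \<open>B\<close>; otherwise, if \<open>A'\<close> has fewer than \<open>s\<close>
  elements, as many are left for the complement of \<open>C\<close>; if both are large, \<open>C\<close> takes exactly \<open>t\<close>
  elements. In each case one of the two parts is finite, so that both are definable from \<open>B\<close> with
  parameters.
\<close>

lemma same_card_upto_split:
  assumes "same_card_upto (t + s) (A \<union> A') B" "A \<inter> A' = {}"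
  obtains C where "C \<subseteq> B" "same_card_upto t A C" "same_card_upto s A' (B - C)" "finite C \<or> finite (B - C)"
proof -
  have card_ge: "at_least q B" if "at_least q (A \<union> A')" "q \<le> t + s" for q
    using assms(1) that by (auto simp: same_card_upto_def)
  consider (small) "\<not> at_least t A" "\<not> at_least s A'"
    | (small_large) "\<not> at_least t A" "at_least s A'"
    | (large_small) "at_least t A" "\<not> at_least s A'"
    | (large) "at_least t A" "at_least s A'" by blast
  then show thesis
  proof cases
    case small
    then have fin: "finite A" "finite A'" "card A < t" "card A' < s" by (auto simp: at_least_def)
    then have c: "card (A \<union> A') = card A + card A'" using assms(2) by (simp add: card_Un_disjoint)
    have "\<not> at_least (t + s) (A \<union> A')" using fin c by (auto simp: at_least_def)
    note B = same_card_upto_small[OF assms(1) this]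
    obtain C where C: "C \<subseteq> B" "finite C" "card C = card A"
      using obtain_subset_with_card_n[of "card A" B] B(3) c by auto
    show thesis
      using C B c fin by (intro that[of C]) (auto intro!: same_card_upto_card simp: card_Diff_subset)
  next
    case small_large
    then have fin: "finite A" "card A < t" by (auto simp: at_least_def)
    then have "at_least (card A + s) (A \<union> A')"
      using small_large assms(2) by (intro at_least_Un_disjoint) (auto simp: at_least_def)
    then have B: "at_least (card A + s) B" using card_ge fin by simp
    then have "at_least (card A) B" by (auto simp: at_least_def)
    then obtain C where C: "C \<subseteq> B" "finite C" "card C = card A" by (rule at_least_obtain)
    show thesis
      using C fin small_large at_least_Diff[OF B, of C]
      by (intro that[of C]) (auto intro: same_card_upto_card same_card_upto_at_least)
  next
    case large_small
    then have fin: "finite A'" "card A' < s" by (auto simp: at_least_def)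
    then have "at_least (t + card A') (A \<union> A')"
      using large_small assms(2) by (intro at_least_Un_disjoint) (auto simp: at_least_def)
    then have B: "at_least (t + card A') B" using card_ge fin by simp
    then have "at_least (card A') B" by (auto simp: at_least_def)
    then obtain C where C: "C \<subseteq> B" "finite C" "card C = card A'" by (rule at_least_obtain)
    have "B - (B - C) = C" using C by auto
    then show thesis
      using C fin large_small B at_least_Diff[of "card A'" t B C]
      by (intro that[of "B - C"]) (auto intro: same_card_upto_card same_card_upto_at_least simp: add.commute)
  next
    case large
    then have "at_least (t + s) (A \<union> A')" using assms(2) by (intro at_least_Un_disjoint)
    then have B: "at_least (t + s) B" using card_ge by simp
    then have "at_least t B" by (auto simp: at_least_def)
    then obtain C where C: "C \<subseteq> B" "finite C" "card C = t" by (rule at_least_obtain)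
    show thesis
      using C large at_least_Diff[OF B, of C] at_least_superset[OF C(2) order_refl]
      by (intro that[of C]) (auto intro!: same_card_upto_at_least)
  qed
qed

text \<open>
  The predicate \<open>I\<close> stands for the sets which exist in a structure. They may form only a
  small part of the power set, but the parts found by \<open>same_card_upto_split\<close> are always among them.
\<close>

lemma same_card_upto_partition:
  assumes "finite L" "L \<noteq> {}" "same_card_upto (card L * t) A B" "h ` A \<subseteq> L"
    and "I B" and I_finite: "\<And>C. C \<subseteq> B \<Longrightarrow> finite C \<Longrightarrow> I C"
    and I_Diff: "\<And>C D. I C \<Longrightarrow> I D \<Longrightarrow> I (C - D)"
  shows "\<exists>h'. h' ` B \<subseteq> L \<and>
    (\<forall>l\<in>L. same_card_upto t {x\<in>A. h x = l} {y\<in>B. h' y = l} \<and> I {y\<in>B. h' y = l})"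
  using assms(1-6)
proof (induction L arbitrary: A B rule: finite_ne_induct)
  case (singleton l)
  then have "{x\<in>A. h x = l} = A" by auto
  with singleton show ?case by (intro exI[of _ "\<lambda>_. l"]) auto
next
  case (insert l L)
  let ?A = "{x\<in>A. h x = l}" and ?A' = "{x\<in>A. h x \<noteq> l}"
  have "same_card_upto (t + card L * t) (?A \<union> ?A') B"
    using insert.prems(1) insert.hyps by (simp add: Collect_disj_eq[symmetric] conj_disj_distribL[symmetric])
  then obtain C where C: "C \<subseteq> B" "same_card_upto t ?A C" "same_card_upto (card L * t) ?A' (B - C)"
      "finite C \<or> finite (B - C)"
    by (rule same_card_upto_split) auto
  have IC: "I C" "I (B - C)"
  proof -
    have "C = B - (B - C)" using C(1) by auto
    then show "I C" "I (B - C)" using C(1,4) insert.prems(3,4) I_Diff by (metis Diff_subset)+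
  qed
  have "h ` ?A' \<subseteq> L" using insert.prems(2) by auto
  moreover have "I D" if "D \<subseteq> B - C" "finite D" for D using that insert.prems(4) by blast
  ultimately have "\<exists>h'. h' ` (B - C) \<subseteq> L \<and> (\<forall>k\<in>L.
      same_card_upto t {x\<in>?A'. h x = k} {y\<in>B - C. h' y = k} \<and> I {y\<in>B - C. h' y = k})"
    using C(3) IC(2) by (intro insert.IH)
  then obtain h' where h': "h' ` (B - C) \<subseteq> L \<and> (\<forall>k\<in>L.
      same_card_upto t {x\<in>?A'. h x = k} {y\<in>B - C. h' y = k} \<and> I {y\<in>B - C. h' y = k})" ..
  define g where "g y = (if y \<in> C then l else h' y)" for y
  have "{y\<in>B. g y = l} = C" using C(1) h' insert.hyps by (auto simp: g_def)
  moreover have "{x\<in>?A'. h x = k} = {x\<in>A. h x = k}" "{y\<in>B. g y = k} = {y\<in>B - C. h' y = k}"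
    if "k \<in> L" for k using that insert.hyps by (auto simp: g_def)
  ultimately have "\<forall>k\<in>insert l L. same_card_upto t {x\<in>A. h x = k} {y\<in>B. g y = k} \<and> I {y\<in>B. g y = k}"
    using C(2) IC(1) h' by simp
  moreover have "g ` B \<subseteq> insert l L" using h' by (auto simp: g_def)
  ultimately show ?case by blast
qed

text \<open>
  The same for a whole labelling \<open>\<kappa>\<close>: an arbitrary refinement \<open>h\<close> on one side is imitated within each class on the
  other side. The price is a division of the threshold by the number of new labels.
\<close>

lemma same_card_upto_refine:
  assumes "finite L" "L \<noteq> {}" "h ` A \<subseteq> L"
    and "\<And>k. same_card_upto (card L * t) {x\<in>A. \<kappa> x = k} {y\<in>B. \<kappa>' y = k}"
    and "\<And>k. I {y\<in>B. \<kappa>' y = k}" and I_finite: "\<And>C. C \<subseteq> B \<Longrightarrow> finite C \<Longrightarrow> I C"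
    and I_Diff: "\<And>C D. I C \<Longrightarrow> I D \<Longrightarrow> I (C - D)"
  obtains h' where "h' ` B \<subseteq> L"
    "\<And>k l. l \<in> L \<Longrightarrow> same_card_upto t {x\<in>A. \<kappa> x = k \<and> h x = l} {y\<in>B. \<kappa>' y = k \<and> h' y = l}"
    "\<And>k l. l \<in> L \<Longrightarrow> I {y\<in>B. \<kappa>' y = k \<and> h' y = l}"
proof -
  have "\<exists>h'. h' ` {y\<in>B. \<kappa>' y = k} \<subseteq> L \<and> (\<forall>l\<in>L.
      same_card_upto t {x\<in>{x\<in>A. \<kappa> x = k}. h x = l} {y\<in>{y\<in>B. \<kappa>' y = k}. h' y = l}
      \<and> I {y\<in>{y\<in>B. \<kappa>' y = k}. h' y = l})" for k
  proof (rule same_card_upto_partition[where I = I and B = "{y\<in>B. \<kappa>' y = k}", OF assms(1,2,4) _ assms(5)])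
    show "h ` {x\<in>A. \<kappa> x = k} \<subseteq> L" using assms(3) by auto
    show "I C" if "C \<subseteq> {y\<in>B. \<kappa>' y = k}" "finite C" for C using that I_finite by blast
    show "I (C - D)" if "I C" "I D" for C D using that I_Diff by blast
  qed
  then have "\<forall>k. \<exists>h'. h' ` {y\<in>B. \<kappa>' y = k} \<subseteq> L \<and> (\<forall>l\<in>L.
      same_card_upto t {x\<in>{x\<in>A. \<kappa> x = k}. h x = l} {y\<in>{y\<in>B. \<kappa>' y = k}. h' y = l}
      \<and> I {y\<in>{y\<in>B. \<kappa>' y = k}. h' y = l})" ..
  from choice[OF this] obtain H where H: "\<forall>k. H k ` {y\<in>B. \<kappa>' y = k} \<subseteq> L \<and> (\<forall>l\<in>L.
      same_card_upto t {x\<in>{x\<in>A. \<kappa> x = k}. h x = l} {y\<in>{y\<in>B. \<kappa>' y = k}. H k y = l}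
      \<and> I {y\<in>{y\<in>B. \<kappa>' y = k}. H k y = l})" ..
  have *: "{y\<in>{y\<in>B. \<kappa>' y = k}. H k y = l} = {y\<in>B. \<kappa>' y = k \<and> H (\<kappa>' y) y = l}"
    "{x\<in>{x\<in>A. \<kappa> x = k}. h x = l} = {x\<in>A. \<kappa> x = k \<and> h x = l}" for k l by auto
  show thesis
  proof (rule that[of "\<lambda>y. H (\<kappa>' y) y"])
    show "(\<lambda>y. H (\<kappa>' y) y) ` B \<subseteq> L" using H by blast
  qed (use H in \<open>simp_all only: *\<close>)
qed

section \<open>Sets definable in type structures\<close>

definition internal :: "(nat \<Rightarrow> 'u set) \<Rightarrow> (nat \<Rightarrow> 'u \<Rightarrow> 'u set) \<Rightarrow> nat \<Rightarrow> 'u set \<Rightarrow> bool" where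
  "internal U X n A \<longleftrightarrow> (\<exists>y\<in>U (Suc n). X n y = A)"

text \<open>
  The instances of comprehension that the argument needs. The last two say that, for an existing
  set \<open>A\<close>, the sets \<open>y\<close> with a member in \<open>A\<close>, and those with a nonmember in \<open>A\<close>, form sets; hence the set
  of the colours of the members (nonmembers) of \<open>y\<close> is a definable property of \<open>y\<close>.
\<close>

locale set_closed =
  fixes U :: "nat \<Rightarrow> 'u set" and X :: "nat \<Rightarrow> 'u \<Rightarrow> 'u set"
  assumes ext_subset: "X n y \<subseteq> U n"
    and ext_inject: "x \<in> U (Suc n) \<Longrightarrow> y \<in> U (Suc n) \<Longrightarrow> X n x = X n y \<Longrightarrow> x = y"
    and internal_singleton: "x \<in> U n \<Longrightarrow> internal U X n {x}"
    and internal_Compl: "internal U X n A \<Longrightarrow> internal U X n (U n - A)"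
    and internal_Un: "internal U X n A \<Longrightarrow> internal U X n B \<Longrightarrow> internal U X n (A \<union> B)"
    and internal_meets: "internal U X n A \<Longrightarrow> internal U X (Suc n) {y \<in> U (Suc n). X n y \<inter> A \<noteq> {}}"
    and internal_omits: "internal U X n A \<Longrightarrow> internal U X (Suc n) {y \<in> U (Suc n). A - X n y \<noteq> {}}"

locale rich = set_closed +
  assumes infinite_base: "infinite (U 0)"
begin

lemma U_nonempty: "U n \<noteq> {}"
proof (induction n)
  case 0 then show ?case using infinite_base by auto
next
  case (Suc n) then show ?case using internal_singleton by (fastforce simp: internal_def)
qed

lemma internal_subset: "internal U X n A \<Longrightarrow> A \<subseteq> U n"
  using ext_subset by (auto simp: internal_def)

lemma internal_Int: "internal U X n A \<Longrightarrow> internal U X n B \<Longrightarrow> internal U X n (A \<inter> B)"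
proof -
  assume a: "internal U X n A" "internal U X n B"
  have "A \<inter> B = U n - ((U n - A) \<union> (U n - B))" using internal_subset a by blast
  with a show ?thesis by (metis internal_Compl internal_Un)
qed

lemma internal_Diff: "internal U X n A \<Longrightarrow> internal U X n B \<Longrightarrow> internal U X n (A - B)"
proof -
  assume a: "internal U X n A" "internal U X n B"
  have "A - B = A \<inter> (U n - B)" using internal_subset a by blast
  with a show ?thesis by (metis internal_Compl internal_Int)
qed

lemma internal_empty: "internal U X n {}"
  using U_nonempty[of n] internal_Diff internal_singleton by (metis Diff_cancel ex_in_conv)

lemma internal_U: "internal U X n (U n)"
  using internal_Compl[OF internal_empty] by simp

lemma internal_finite: "finite A \<Longrightarrow> A \<subseteq> U n \<Longrightarrow> internal U X n A"
proof (induction A rule: finite_induct)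
  case (insert x A)
  then show ?case using internal_Un[OF internal_singleton[of x n], of A] by simp
qed (rule internal_empty)

lemma internal_Union: "finite J \<Longrightarrow> (\<And>j. j \<in> J \<Longrightarrow> internal U X n (A j)) \<Longrightarrow> internal U X n (\<Union>j\<in>J. A j)"
  by (induction J rule: finite_induct) (auto intro: internal_empty internal_Un)

text \<open>
  If finitely many properties each define a set, then so does any prescribed pattern of them; colours are
  built from the codes of such patterns.
\<close>

lemma internal_set_encode:
  assumes "finite J" "\<And>j. j \<in> J \<Longrightarrow> internal U X n {x \<in> U n. P j x}"
  shows "internal U X n {x \<in> U n. set_encode {j\<in>J. P j x} = l}"
proof -
  have *: "internal U X n {x \<in> U n. \<forall>j\<in>J'. P j x \<longleftrightarrow> j \<in> S}" if "finite J'" "J' \<subseteq> J" for J' S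
    using that
  proof (induction J' rule: finite_induct)
    case empty then show ?case using internal_U by simp
  next
    case (insert j J')
    have "{x \<in> U n. \<forall>j\<in>insert j J'. P j x \<longleftrightarrow> j \<in> S}
      = {x \<in> U n. \<forall>j\<in>J'. P j x \<longleftrightarrow> j \<in> S} \<inter>
        (if j \<in> S then {x \<in> U n. P j x} else U n - {x \<in> U n. P j x})" by auto
    with insert assms(2)[of j] show ?case by (auto intro!: internal_Int internal_Compl)
  qed
  have "set_encode {j\<in>J. P j x} = l \<longleftrightarrow> {j\<in>J. P j x} = set_decode l" for x
    using assms(1) by (metis finite_Collect_conjI finite_set_decode set_decode_inverse set_encode_inverse Collect_mem_eq)
  then have "{x \<in> U n. set_encode {j\<in>J. P j x} = l}
      = (if set_decode l \<subseteq> J then {x \<in> U n. \<forall>j\<in>J. P j x \<longleftrightarrow> j \<in> set_decode l} else {})"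
    by auto
  then show ?thesis using *[OF assms(1) order_refl] internal_empty by simp
qed

lemma internal_prod_encode:
  assumes "\<And>l. internal U X n {x \<in> U n. f x = l}" "\<And>l. internal U X n {x \<in> U n. g x = l}"
  shows "internal U X n {x \<in> U n. prod_encode (f x, g x) = l}"
proof -
  have "prod_encode (f x, g x) = l \<longleftrightarrow> f x = fst (prod_decode l) \<and> g x = snd (prod_decode l)" for x
    by (metis prod.collapse prod.inject prod_decode_inverse prod_encode_inverse)
  then have "{x \<in> U n. prod_encode (f x, g x) = l}
    = {x \<in> U n. f x = fst (prod_decode l)} \<inter> {x \<in> U n. g x = snd (prod_decode l)}" by auto
  with assms show ?thesis by (simp add: internal_Int)
qed

end

section \<open>Colours\<close>

text \<open>
  Colours are relative to parameters \<open>a n i\<close> of type \<open>n\<close>, of which only those with \<open>i < m\<close> count. As colours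
  in different structures are compared, they are coded by natural numbers. The function \<open>set_encode\<close> is
  injective on finite sets only, which is harmless since there are finitely many colours of each type.
\<close>

definition owners :: "(nat \<Rightarrow> 'u \<Rightarrow> 'u set) \<Rightarrow> (nat \<Rightarrow> nat \<Rightarrow> 'u) \<Rightarrow> nat \<Rightarrow> nat \<Rightarrow> 'u \<Rightarrow> nat" where
  "owners X a m n x = set_encode {i\<in>{..<m}. x \<in> X n (a (Suc n) i)}"

definition profile :: "(nat \<Rightarrow> 'u set) \<Rightarrow> (nat \<Rightarrow> 'u \<Rightarrow> 'u set) \<Rightarrow> ('u \<Rightarrow> nat) \<Rightarrow> nat \<Rightarrow> 'u \<Rightarrow> nat" where
  "profile U X \<kappa> n x = prod_encode (set_encode (\<kappa> ` X n x), set_encode (\<kappa> ` (U n - X n x)))"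

text \<open>
  The colour of \<open>x\<close> consists of the parameters one type above which contain \<open>x\<close>, and of its content: for
  type 0, the parameters equal to \<open>x\<close>; otherwise the colours of the members and the colours of the
  nonmembers of \<open>x\<close>. The content does not depend on the parameters above the type of \<open>x\<close>, so in a
  construction from below it is known before the owners are.
\<close>

primrec content ::
  "(nat \<Rightarrow> 'u set) \<Rightarrow> (nat \<Rightarrow> 'u \<Rightarrow> 'u set) \<Rightarrow> (nat \<Rightarrow> nat \<Rightarrow> 'u) \<Rightarrow> nat \<Rightarrow> nat \<Rightarrow> 'u \<Rightarrow> nat" where
  "content U X a m 0 = (\<lambda>x. set_encode {i\<in>{..<m}. x = a 0 i})"
| "content U X a m (Suc n) = profile U X (\<lambda>x. prod_encode (owners X a m n x, content U X a m n x)) n"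

definition colour ::
  "(nat \<Rightarrow> 'u set) \<Rightarrow> (nat \<Rightarrow> 'u \<Rightarrow> 'u set) \<Rightarrow> (nat \<Rightarrow> nat \<Rightarrow> 'u) \<Rightarrow> nat \<Rightarrow> nat \<Rightarrow> 'u \<Rightarrow> nat" where
  "colour U X a m n x = prod_encode (owners X a m n x, content U X a m n x)"

lemma content_Suc: "content U X a m (Suc n) = profile U X (colour U X a m n) n"
  by (simp add: colour_def[abs_def])

lemma content_cong: "(\<And>k. k \<le> n \<Longrightarrow> a k = b k) \<Longrightarrow> content U X a m n = content U X b m n"
  by (induction n) (simp_all add: owners_def)

lemma colour_cong: "(\<And>k. k \<le> Suc n \<Longrightarrow> a k = b k) \<Longrightarrow> colour U X a m n = colour U X b m n"
  using content_cong[of n a b U X m] by (simp add: colour_def[abs_def] owners_def)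

lemma colour_eq_iff:
  "colour U X a m n x = l \<longleftrightarrow> owners X a m n x = fst (prod_decode l) \<and> content U X a m n x = snd (prod_decode l)"
  unfolding colour_def by (metis prod.collapse prod.inject prod_decode_inverse prod_encode_inverse)

lemma owners_range: "owners X a m n x \<in> set_encode ` Pow {..<m}"
  by (auto simp: owners_def)

context rich
begin

lemma finite_colours: "finite (colour U X a m n ` U n)"
proof (induction n)
  case 0
  have "colour U X a m 0 ` U 0 \<subseteq> prod_encode ` (set_encode ` Pow {..<m} \<times> set_encode ` Pow {..<m})"
    by (auto simp: colour_def owners_def)
  then show ?case by (rule finite_subset) simp
next
  case (Suc n)
  let ?C = "set_encode ` Pow (colour U X a m n ` U n)"
  have "content U X a m (Suc n) x \<in> prod_encode ` (?C \<times> ?C)" for x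
    unfolding content_Suc profile_def
    by (intro imageI SigmaI PowI image_mono ext_subset Diff_subset)
  then have "colour U X a m (Suc n) ` U (Suc n) \<subseteq> prod_encode ` (set_encode ` Pow {..<m} \<times> prod_encode ` (?C \<times> ?C))"
    unfolding colour_def by (intro image_subsetI imageI SigmaI owners_range) simp
  moreover have "finite (prod_encode ` (set_encode ` Pow {..<m} \<times> prod_encode ` (?C \<times> ?C)))"
    using Suc by simp
  ultimately show ?case by (rule finite_subset)
qed

lemma internal_owners:
  assumes "valuation U a"
  shows "internal U X n {x \<in> U n. owners X a m n x = l}"
  unfolding owners_def
proof (rule internal_set_encode)
  fix i
  have "{x \<in> U n. x \<in> X n (a (Suc n) i)} = X n (a (Suc n) i)" using ext_subset by auto
  then show "internal U X n {x \<in> U n. x \<in> X n (a (Suc n) i)}"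
    using assms by (auto simp: internal_def valuation_def)
qed simp

lemma internal_profile:
  assumes "finite (\<kappa> ` U n)" "\<And>l. internal U X n {x \<in> U n. \<kappa> x = l}"
  shows "internal U X (Suc n) {x \<in> U (Suc n). profile U X \<kappa> n x = l}"
  unfolding profile_def
proof (rule internal_prod_encode)
  \<comment> \<open>A colour occurs in \<open>A\<close> iff \<open>A\<close> meets its class, and the classes are sets.\<close>
  have img: "\<kappa> ` A = {c \<in> \<kappa> ` U n. A \<inter> {z \<in> U n. \<kappa> z = c} \<noteq> {}}" if "A \<subseteq> U n" for A
    using that by (intro set_eqI) (auto 4 4 simp: image_iff)
  have out: "(U n - X n x) \<inter> {z \<in> U n. \<kappa> z = c} = {z \<in> U n. \<kappa> z = c} - X n x" for x c by auto
  show "internal U X (Suc n) {x \<in> U (Suc n). set_encode (\<kappa> ` X n x) = l}" for l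
    by (subst img[OF ext_subset], rule internal_set_encode[OF assms(1)], rule internal_meets[OF assms(2)])
  show "internal U X (Suc n) {x \<in> U (Suc n). set_encode (\<kappa> ` (U n - X n x)) = l}" for l
    by (subst img[OF Diff_subset], rule internal_set_encode[OF assms(1)], subst out, rule internal_omits[OF assms(2)])
qed

lemma internal_content:
  assumes "valuation U a"
  shows "internal U X n {x \<in> U n. content U X a m n x = l}"
proof (induction n arbitrary: l)
  case 0
  have "internal U X 0 {x \<in> U 0. x = a 0 i}" for i
    using assms by (intro internal_finite) (auto simp: valuation_def)
  then have "internal U X 0 {x \<in> U 0. set_encode {i\<in>{..<m}. x = a 0 i} = l}"
    by (intro internal_set_encode) auto
  then show ?case by simp
next
  case (Suc n)
  have "internal U X n {x \<in> U n. colour U X a m n x = l}" for l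
    unfolding colour_def using Suc internal_owners[OF assms] by (intro internal_prod_encode)
  then show ?case unfolding content_Suc by (intro internal_profile finite_colours)
qed

lemma internal_colour:
  assumes "valuation U a"
  shows "internal U X n {x \<in> U n. colour U X a m n x = l}"
  unfolding colour_def using internal_content internal_owners assms by (intro internal_prod_encode)

end

section \<open>Copying parameters into another structure\<close>

text \<open>
  Given \<open>q\<close> sets in the first structure with the profile \<open>p\<close>, label each element by the sets among them
  that contain it. This cuts each class of \<open>\<kappa>\<close> into at most \<open>2 ^ q\<close> pieces. Imitating the pieces in the second
  structure, up to the threshold 1 only, gives \<open>q\<close> sets there: their profile is \<open>p\<close> because the same pairs
  of labels occur, and they are distinct because two of the given sets are separated by some label.
\<close>

lemma at_least_profile:
  assumes "rich U X" "rich V Y" "q \<le> t"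
    and same: "\<And>k. same_card_upto (2 ^ t) {x \<in> U n. \<kappa> x = k} {y \<in> V n. \<kappa>' y = k}"
    and int: "\<And>k. internal V Y n {y \<in> V n. \<kappa>' y = k}" and fin: "finite (\<kappa>' ` V n)"
    and q: "at_least q {x \<in> U (Suc n). profile U X \<kappa> n x = p}"
  shows "at_least q {y \<in> V (Suc n). profile V Y \<kappa>' n y = p}"
proof -
  interpret M: rich U X by fact
  interpret N: rich V Y by fact
  from q obtain F where F: "F \<subseteq> {x \<in> U (Suc n). profile U X \<kappa> n x = p}" "finite F" "card F = q"
    by (rule at_least_obtain)
  define h where "h z = {x \<in> F. z \<in> X n x}" for z
  have "card (Pow F) * 1 \<le> 2 ^ t" using F(2,3) assms(3) by (simp add: card_Pow)
  with same have same': "same_card_upto (card (Pow F) * 1) {x \<in> U n. \<kappa> x = k} {y \<in> V n. \<kappa>' y = k}" for k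
    by (rule same_card_upto_mono)
  obtain h' where h': "h' ` V n \<subseteq> Pow F"
    "\<And>k S. S \<in> Pow F \<Longrightarrow> same_card_upto 1 {z \<in> U n. \<kappa> z = k \<and> h z = S} {w \<in> V n. \<kappa>' w = k \<and> h' w = S}"
    "\<And>k S. S \<in> Pow F \<Longrightarrow> internal V Y n {w \<in> V n. \<kappa>' w = k \<and> h' w = S}"
    by (rule same_card_upto_refine[where A = "U n" and L = "Pow F" and h = h and B = "V n" and
          \<kappa> = \<kappa> and \<kappa>' = \<kappa>' and t = 1 and I = "internal V Y n", OF _ _ _ same' int])
      (use F(2) in \<open>auto simp: h_def intro: N.internal_finite N.internal_Diff\<close>)
  have same_pairs: "(\<exists>z\<in>U n. \<kappa> z = k \<and> h z = S) \<longleftrightarrow> (\<exists>w\<in>V n. \<kappa>' w = k \<and> h' w = S)" if "S \<subseteq> F" for k S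
    using same_card_upto_empty[OF h'(2)[of S k]] that by auto
  have "internal V Y n {w \<in> V n. x \<in> h' w}" for x
  proof -
    have "{w \<in> V n. x \<in> h' w} = (\<Union>(k, S)\<in>\<kappa>' ` V n \<times> {S \<in> Pow F. x \<in> S}. {w \<in> V n. \<kappa>' w = k \<and> h' w = S})"
      using h'(1) by auto
    also have "internal V Y n \<dots>"
      using fin F(2) h'(3) by (intro N.internal_Union) auto
    finally show ?thesis .
  qed
  then obtain g where g: "\<And>x. g x \<in> V (Suc n)" "\<And>x. Y n (g x) = {w \<in> V n. x \<in> h' w}"
    unfolding internal_def by metis
  have h_sub: "h z \<subseteq> F" for z by (auto simp: h_def)
  have h'_sub: "h' w \<subseteq> F" if "w \<in> V n" for w using h'(1) that by auto
  have prof: "profile V Y \<kappa>' n (g x) = p" if "x \<in> F" for x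
  proof -
    have X: "X n x = {z \<in> U n. x \<in> h z}" using that M.ext_subset by (auto simp: h_def)
    have "\<kappa> ` X n x = \<kappa>' ` Y n (g x)"
    proof (intro set_eqI iffI)
      fix k assume "k \<in> \<kappa> ` X n x"
      then obtain z where "z \<in> U n" "\<kappa> z = k" "x \<in> h z" using X by auto
      with same_pairs[OF h_sub, of k z] have "\<exists>w\<in>V n. \<kappa>' w = k \<and> x \<in> h' w" by blast
      then show "k \<in> \<kappa>' ` Y n (g x)" by (auto simp: g)
    next
      fix k assume "k \<in> \<kappa>' ` Y n (g x)"
      then obtain w where "w \<in> V n" "\<kappa>' w = k" "x \<in> h' w" by (auto simp: g)
      with same_pairs[OF h'_sub, of w k] have "\<exists>z\<in>U n. \<kappa> z = k \<and> x \<in> h z" by blast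
      then show "k \<in> \<kappa> ` X n x" using X by auto
    qed
    moreover have "\<kappa> ` (U n - X n x) = \<kappa>' ` (V n - Y n (g x))"
    proof (intro set_eqI iffI)
      fix k assume "k \<in> \<kappa> ` (U n - X n x)"
      then obtain z where "z \<in> U n" "\<kappa> z = k" "x \<notin> h z" using X by auto
      with same_pairs[OF h_sub, of k z] have "\<exists>w\<in>V n. \<kappa>' w = k \<and> x \<notin> h' w" by blast
      then show "k \<in> \<kappa>' ` (V n - Y n (g x))" by (auto simp: g)
    next
      fix k assume "k \<in> \<kappa>' ` (V n - Y n (g x))"
      then obtain w where "w \<in> V n" "\<kappa>' w = k" "x \<notin> h' w" by (auto simp: g)
      with same_pairs[OF h'_sub, of w k] have "\<exists>z\<in>U n. \<kappa> z = k \<and> x \<notin> h z" by blast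
      then show "k \<in> \<kappa> ` (U n - X n x)" using X by auto
    qed
    ultimately have "profile V Y \<kappa>' n (g x) = profile U X \<kappa> n x" by (simp add: profile_def)
    with F(1) that show ?thesis by auto
  qed
  have "inj_on g F"
  proof (rule inj_onI)
    fix x x' assume x: "x \<in> F" "x' \<in> F" "g x = g x'"
    have "z \<in> X n x \<longleftrightarrow> z \<in> X n x'" if "z \<in> U n" for z
    proof -
      obtain w where "w \<in> V n" "h' w = h z" using same_pairs[OF h_sub, of "\<kappa> z" z] \<open>z \<in> U n\<close> by blast
      moreover have "{w \<in> V n. x \<in> h' w} = {w \<in> V n. x' \<in> h' w}" using g(2) x(3) by metis
      ultimately have "x \<in> h z \<longleftrightarrow> x' \<in> h z" by blast
      then show ?thesis using x by (auto simp: h_def)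
    qed
    then have "X n x = X n x'" using M.ext_subset by blast
    then show "x = x'" using x F(1) by (intro M.ext_inject) auto
  qed
  then have "card (g ` F) = q" using F(3) by (simp add: card_image)
  moreover have "g ` F \<subseteq> {y \<in> V (Suc n). profile V Y \<kappa>' n y = p}" using g(1) prof by auto
  ultimately show ?thesis using F(2) at_least_superset by blast
qed

lemma same_card_upto_profile:
  assumes "rich U X" "rich V Y"
    and "\<And>k. same_card_upto (2 ^ t) {x \<in> U n. \<kappa> x = k} {y \<in> V n. \<kappa>' y = k}"
    and "\<And>k. internal U X n {x \<in> U n. \<kappa> x = k}" "finite (\<kappa> ` U n)"
    and "\<And>k. internal V Y n {y \<in> V n. \<kappa>' y = k}" "finite (\<kappa>' ` V n)"
  shows "same_card_upto t {x \<in> U (Suc n). profile U X \<kappa> n x = p} {y \<in> V (Suc n). profile V Y \<kappa>' n y = p}"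
  unfolding same_card_upto_def
proof (intro allI impI iffI)
  fix q assume "q \<le> t" "at_least q {x \<in> U (Suc n). profile U X \<kappa> n x = p}"
  then show "at_least q {y \<in> V (Suc n). profile V Y \<kappa>' n y = p}"
    using assms at_least_profile[of U X V Y q t n \<kappa> \<kappa>' p] by blast
next
  fix q assume "q \<le> t" "at_least q {y \<in> V (Suc n). profile V Y \<kappa>' n y = p}"
  then show "at_least q {x \<in> U (Suc n). profile U X \<kappa> n x = p}"
    using assms at_least_profile[of V Y U X q t n \<kappa>' \<kappa> p] same_card_upto_sym[OF assms(3)] by blast
qed

text \<open>
  The parameters of type \<open>n + 1\<close> refine the classes of equal content at type \<open>n\<close> into at most \<open>2 ^ m\<close>
  parts each. The copies of the parameters are the unions of the corresponding parts in the second structure.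
\<close>

lemma copy_owners:
  assumes "rich U X" "rich V Y" "valuation V b"
    and same: "\<And>p. same_card_upto (2 ^ m * t) {x \<in> U n. content U X a m n x = p} {y \<in> V n. content V Y b m n y = p}"
  obtains b' where "valuation V b'" "\<And>k. k \<noteq> Suc n \<Longrightarrow> b' k = b k"
    "\<And>l. same_card_upto t {x \<in> U n. colour U X a m n x = l} {y \<in> V n. colour V Y b' m n y = l}"
proof -
  interpret M: rich U X by fact
  interpret N: rich V Y by fact
  define L where "L = set_encode ` Pow {..<m}"
  have "card L \<le> 2 ^ m" unfolding L_def using card_image_le[of "Pow {..<m}" set_encode] by (simp add: card_Pow)
  then have "card L * t \<le> 2 ^ m * t" by simp
  with same have same': "same_card_upto (card L * t) {x \<in> U n. content U X a m n x = p} {y \<in> V n. content V Y b m n y = p}" for p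
    by (rule same_card_upto_mono)
  obtain h where h: "h ` V n \<subseteq> L"
    "\<And>p l. l \<in> L \<Longrightarrow> same_card_upto t {x \<in> U n. content U X a m n x = p \<and> owners X a m n x = l}
       {y \<in> V n. content V Y b m n y = p \<and> h y = l}"
    "\<And>p l. l \<in> L \<Longrightarrow> internal V Y n {y \<in> V n. content V Y b m n y = p \<and> h y = l}"
    by (rule same_card_upto_refine[where A = "U n" and L = L and h = "owners X a m n" and B = "V n" and
          \<kappa> = "content U X a m n" and \<kappa>' = "content V Y b m n" and t = t and I = "internal V Y n",
          OF _ _ _ same' N.internal_content])
      (use assms(3) in \<open>auto simp: L_def owners_def intro: N.internal_finite N.internal_Diff\<close>)
  have fin: "finite (content V Y b m n ` V n)"
  proof -
    have "content V Y b m n ` V n = (snd \<circ> prod_decode) ` colour V Y b m n ` V n"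
      by (auto simp: colour_def image_iff)
    then show ?thesis using N.finite_colours by simp
  qed
  have "internal V Y n {y \<in> V n. i \<in> set_decode (h y)}" for i
  proof -
    have "{y \<in> V n. i \<in> set_decode (h y)} = (\<Union>(p, l)\<in>content V Y b m n ` V n \<times> {l \<in> L. i \<in> set_decode l}.
        {y \<in> V n. content V Y b m n y = p \<and> h y = l})"
      using h(1) by auto
    also have "internal V Y n \<dots>"
      using fin h(3) by (intro N.internal_Union) (auto simp: L_def)
    finally show ?thesis .
  qed
  then obtain f where f: "\<And>i. f i \<in> V (Suc n)" "\<And>i. Y n (f i) = {y \<in> V n. i \<in> set_decode (h y)}"
    unfolding internal_def by metis
  define b' where "b' = b(Suc n := f)"
  have cont: "content V Y b' m n = content V Y b m n"
    by (rule content_cong) (simp add: b'_def)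
  have own: "owners Y b' m n y = h y" if "y \<in> V n" for y
  proof -
    have "h y \<in> set_encode ` Pow {..<m}" using h(1) that unfolding L_def by blast
    then obtain S where S: "h y = set_encode S" "S \<subseteq> {..<m}" by (elim imageE) auto
    then have "set_decode (h y) = S" by (simp add: finite_subset)
    then have "{i\<in>{..<m}. y \<in> Y n (b' (Suc n) i)} = S" using S(2) that by (auto simp: b'_def f)
    then show ?thesis by (simp add: owners_def S(1))
  qed
  show thesis
  proof (rule that[of b'])
    show "valuation V b'" using assms(3) f(1) by (simp add: valuation_def b'_def)
    show "b' k = b k" if "k \<noteq> Suc n" for k using that by (simp add: b'_def)
    fix l
    let ?o = "fst (prod_decode l)" and ?p = "snd (prod_decode l)"
    have *: "{x \<in> U n. colour U X a m n x = l} = {x \<in> U n. content U X a m n x = ?p \<and> owners X a m n x = ?o}"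
      by (auto simp: colour_eq_iff)
    have **: "{y \<in> V n. colour V Y b' m n y = l} = {y \<in> V n. content V Y b m n y = ?p \<and> h y = ?o}"
      by (auto simp: colour_eq_iff own cont)
    show "same_card_upto t {x \<in> U n. colour U X a m n x = l} {y \<in> V n. colour V Y b' m n y = l}"
    proof (cases "?o \<in> L")
      case True then show ?thesis unfolding * ** by (rule h(2))
    next
      case False
      moreover have "owners X a m n x \<in> L" for x unfolding L_def by (rule owners_range)
      moreover have "h y \<in> L" if "y \<in> V n" for y using h(1) that by blast
      ultimately have "{x \<in> U n. content U X a m n x = ?p \<and> owners X a m n x = ?o} = {}"
        "{y \<in> V n. content V Y b m n y = ?p \<and> h y = ?o} = {}"
        by (metis (mono_tags, lifting) empty_Collect_eq)+
      then show ?thesis unfolding * ** by (simp only: same_card_upto_card finite.emptyI card.empty)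
    qed
  qed
qed

text \<open>
  Any injection of the parameters of type 0 will do, as the remaining elements, whose content is
  coded by 0, are infinitely many on both sides.
\<close>

lemma copy_urelements:
  assumes "rich U X" "rich V Y" "valuation U a"
  obtains b where "valuation V b"
    "\<And>t p. same_card_upto t {x \<in> U 0. content U X a m 0 x = p} {y \<in> V 0. content V Y b m 0 y = p}"
proof -
  interpret M: rich U X by fact
  interpret N: rich V Y by fact
  define A where "A = a 0 ` {..<m}"
  have "finite A" by (simp add: A_def)
  obtain B where B: "B \<subseteq> V 0" "finite B" "card B = card A"
    using infinite_arbitrarily_large[OF N.infinite_base] by blast
  then obtain g where g: "bij_betw g A B"
    using finite_same_card_bij[OF \<open>finite A\<close> B(2) B(3)[symmetric]] by blast
  define d where "d n = (SOME y. y \<in> V n)" for n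
  have d: "d n \<in> V n" for n unfolding d_def some_in_eq by (rule N.U_nonempty)
  define b where "b n i = (if n = 0 \<and> i < m then g (a 0 i) else d n)" for n i
  have b0: "b 0 i = g (a 0 i)" "a 0 i \<in> A" if "i < m" for i using that by (auto simp: b_def A_def)
  have val: "valuation V b"
    using g B(1) d by (auto simp: valuation_def b_def A_def bij_betw_def)
  show thesis
  proof (rule that[OF val])
    fix t p
    let ?P = "{x \<in> U 0. content U X a m 0 x = p}" and ?Q = "{y \<in> V 0. content V Y b m 0 y = p}"
    have inA: "x \<in> A \<longleftrightarrow> content U X a m 0 x \<noteq> 0" for x
      using set_encode_eq[of "{i \<in> {..<m}. x = a 0 i}" "{}"] by (auto simp: A_def)
    have inB: "y \<in> B \<longleftrightarrow> content V Y b m 0 y \<noteq> 0" for y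
    proof -
      have "y \<in> B \<longleftrightarrow> (\<exists>i<m. y = b 0 i)" using g b0 by (auto simp: bij_betw_def A_def)
      then show ?thesis using set_encode_eq[of "{i \<in> {..<m}. y = b 0 i}" "{}"] by auto
    qed
    show "same_card_upto t ?P ?Q"
    proof (cases "p = 0")
      case True
      then have "?P = U 0 - A" "?Q = V 0 - B" by (auto simp: inA inB simp del: content.simps)
      then have "infinite ?P" "infinite ?Q"
        using M.infinite_base N.infinite_base \<open>finite A\<close> B(2) by auto
      then show ?thesis by (auto simp: same_card_upto_def at_least_def)
    next
      case False
      have "A \<subseteq> U 0" using assms(3) by (auto simp: A_def valuation_def)
      have cg: "content V Y b m 0 (g x) = content U X a m 0 x" if "x \<in> A" for x
      proof -
        have "g x = b 0 i \<longleftrightarrow> x = a 0 i" if "i < m" for i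
          using b0[OF that] g \<open>x \<in> A\<close> by (metis bij_betw_def inj_onD)
        then have "{i \<in> {..<m}. g x = b 0 i} = {i \<in> {..<m}. x = a 0 i}" by auto
        then show ?thesis by simp
      qed
      have P: "?P = {x \<in> A. content U X a m 0 x = p}" "?Q = {y \<in> B. content V Y b m 0 y = p}"
        using False \<open>A \<subseteq> U 0\<close> B(1) by (auto simp: inA inB simp del: content.simps)
      have "?Q = g ` ?P" unfolding P using g cg by (auto simp: bij_betw_def)
      moreover have "inj_on g ?P" unfolding P using g by (auto simp: bij_betw_def inj_on_def)
      moreover have "finite ?P" unfolding P using \<open>finite A\<close> by simp
      ultimately show ?thesis
        by (simp only: finite_imageI card_image same_card_upto_card)
    qed
  qed
qed

text \<open>
  Induction on the type. Reaching the threshold \<open>t\<close> for type \<open>s + 1\<close> needs \<open>2 ^ m * t\<close> for the contents,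
  because of the owners, hence \<open>2 ^ (2 ^ m * t)\<close> for the colours of type \<open>s\<close>. Choosing the parameters of
  type \<open>s + 2\<close> leaves the colours up to type \<open>s\<close> unchanged.
\<close>

theorem copy_parameters:
  assumes "rich U X" "rich V Y" "valuation U a"
  shows "\<exists>b. valuation V b \<and> (\<forall>n\<le>s. \<forall>l. same_card_upto t {x \<in> U n. colour U X a m n x = l} {y \<in> V n. colour V Y b m n y = l})"
proof -
  interpret M: rich U X by fact
  interpret N: rich V Y by fact
  show ?thesis
  proof (induction s arbitrary: t)
    case 0
    obtain b where b: "valuation V b"
      "\<And>t p. same_card_upto t {x \<in> U 0. content U X a m 0 x = p} {y \<in> V 0. content V Y b m 0 y = p}"
      by (rule copy_urelements[OF assms, where m = m]) (rule that, assumption+)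
    show ?case
      by (rule copy_owners[OF assms(1,2) b]) blast
  next
    case (Suc s)
    obtain b where b: "valuation V b"
      and same: "\<And>n l. n \<le> s \<Longrightarrow> same_card_upto (max t (2 ^ (2 ^ m * t))) {x \<in> U n. colour U X a m n x = l} {y \<in> V n. colour V Y b m n y = l}"
      using Suc.IH by blast
    have "same_card_upto (2 ^ m * t) {x \<in> U (Suc s). content U X a m (Suc s) x = p} {y \<in> V (Suc s). content V Y b m (Suc s) y = p}" for p
      unfolding content_Suc
    proof (rule same_card_upto_profile[OF assms(1,2)])
      show "same_card_upto (2 ^ (2 ^ m * t)) {x \<in> U s. colour U X a m s x = k} {y \<in> V s. colour V Y b m s y = k}" for k
        using same_card_upto_mono[OF same[of s k]] by simp
    qed (intro M.internal_colour M.finite_colours N.internal_colour N.finite_colours b assms)+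
    then obtain b' where b': "valuation V b'" "\<And>k. k \<noteq> Suc (Suc s) \<Longrightarrow> b' k = b k"
      "\<And>l. same_card_upto t {x \<in> U (Suc s). colour U X a m (Suc s) x = l} {y \<in> V (Suc s). colour V Y b' m (Suc s) y = l}"
      by (rule copy_owners[OF assms(1,2) b]) blast
    have "same_card_upto t {x \<in> U n. colour U X a m n x = l} {y \<in> V n. colour V Y b' m n y = l}" if "n \<le> Suc s" for n l
    proof (cases "n = Suc s")
      case True then show ?thesis using b'(3) by simp
    next
      case False
      then have "n \<le> s" using that by simp
      then have "colour V Y b' m n = colour V Y b m n" by (intro colour_cong) (simp add: b'(2))
      then show ?thesis using same_card_upto_mono[OF same[OF \<open>n \<le> s\<close>]] by simp
    qed
    with b'(1) show ?case by blast
  qed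
qed

section \<open>Matching new elements by colour\<close>

lemma same_colour_owners:
  assumes "colour U X a m n x = colour V Y b m n y" "i < m"
  shows "x \<in> X n (a (Suc n) i) \<longleftrightarrow> y \<in> Y n (b (Suc n) i)"
proof -
  have "{i\<in>{..<m}. x \<in> X n (a (Suc n) i)} = {i\<in>{..<m}. y \<in> Y n (b (Suc n) i)}"
    using assms(1) by (simp add: colour_def owners_def set_encode_eq)
  with assms(2) show ?thesis by blast
qed

lemma same_colour_members:
  assumes "rich U X" "rich V Y" "colour U X a m (Suc n) x = colour V Y b m (Suc n) y"
  shows "colour U X a m n ` X n x = colour V Y b m n ` Y n y"
    and "colour U X a m n ` (U n - X n x) = colour V Y b m n ` (V n - Y n y)"
proof -
  interpret M: rich U X by fact
  interpret N: rich V Y by fact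
  have fin: "finite (colour U X a m n ` A)" "finite (colour V Y b m n ` B)" if "A \<subseteq> U n" "B \<subseteq> V n" for A B
    using M.finite_colours[of a m n] N.finite_colours[of b m n] that by (meson finite_subset image_mono)+
  have "set_encode (colour U X a m n ` X n x) = set_encode (colour V Y b m n ` Y n y)"
    "set_encode (colour U X a m n ` (U n - X n x)) = set_encode (colour V Y b m n ` (V n - Y n y))"
    using assms(3) by (simp_all add: colour_def[of _ _ _ _ "Suc n"] content_Suc profile_def del: content.simps)
  then show "colour U X a m n ` X n x = colour V Y b m n ` Y n y"
    "colour U X a m n ` (U n - X n x) = colour V Y b m n ` (V n - Y n y)"
    using set_encode_eq fin M.ext_subset N.ext_subset by (metis Diff_subset)+
qed

text \<open>
  In type 0 the colour says so. In higher types it suffices by extensionality to compare members: an element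
  \<open>w\<close> of the second structure has the colour of some \<open>z\<close> in the first one with \<open>z \<in> x\<close> iff \<open>w \<in> y\<close>, and
  the owners in this colour tell whether \<open>z\<close> is in \<open>x = a n i\<close> and whether \<open>w\<close> is in \<open>b n i\<close>.
\<close>

lemma same_colour_parameter1:
  assumes "rich U X" "rich V Y" "valuation V b" "i < m" "y \<in> V n"
    and "colour U X a m n x = colour V Y b m n y" "x = a n i"
  shows "y = b n i"
proof -
  interpret M: rich U X by fact
  interpret N: rich V Y by fact
  show ?thesis
  proof (cases n)
    case 0
    then have "set_encode {i\<in>{..<m}. x = a 0 i} = set_encode {i\<in>{..<m}. y = b 0 i}"
      using assms(6) by (simp add: colour_def)
    then have "{i\<in>{..<m}. x = a 0 i} = {i\<in>{..<m}. y = b 0 i}" by (simp add: set_encode_eq)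
    with assms(4,7) 0 show ?thesis by blast
  next
    case (Suc k)
    note mem = same_colour_members[OF assms(1,2) assms(6)[unfolded Suc]]
    have "w \<in> Y k y \<longleftrightarrow> w \<in> Y k (b (Suc k) i)" if "w \<in> V k" for w
    proof (cases "w \<in> Y k y")
      case True
      then obtain z where "z \<in> X k x" "colour U X a m k z = colour V Y b m k w" using mem(1) by (metis imageE imageI)
      then show ?thesis using True assms(4,7) Suc same_colour_owners by metis
    next
      case False
      with that have "colour V Y b m k w \<in> colour U X a m k ` (U k - X k x)" using mem(2) by auto
      then obtain z where "z \<notin> X k x" "colour U X a m k z = colour V Y b m k w" by auto
      then show ?thesis using False assms(4,7) Suc same_colour_owners by metis
    qed
    then have "Y k y = Y k (b (Suc k) i)" using N.ext_subset by blast
    then show ?thesis using assms(3,5) Suc by (auto simp: valuation_def intro: N.ext_inject)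
  qed
qed

lemma same_colour_parameter:
  assumes "rich U X" "rich V Y" "valuation U a" "valuation V b" "i < m" "x \<in> U n" "y \<in> V n"
    and "colour U X a m n x = colour V Y b m n y"
  shows "x = a n i \<longleftrightarrow> y = b n i"
proof
  show "y = b n i" if "x = a n i" using same_colour_parameter1[OF assms(1,2,4,5,7,8) that] .
  show "x = a n i" if "y = b n i" using same_colour_parameter1[OF assms(2,1,3,5,6) assms(8)[symmetric] that] .
qed

text \<open>
  The elements \<open>d n\<close> are chosen from the highest relevant type downwards, with the colours of \<open>c n\<close>. As
  \<open>d (n + 1)\<close> has the colour of \<open>c (n + 1)\<close>, the colour of \<open>c n\<close> occurs among the members of
  \<open>d (n + 1)\<close> if \<open>c n\<close> is a member of \<open>c (n + 1)\<close>, and among the nonmembers otherwise. Each \<open>d n\<close> has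
  only one such condition to meet because there is only one new element of each type.
\<close>

theorem realise_over_copy:
  assumes "rich U X" "rich V Y" "valuation U a"
  shows "\<exists>b. valuation V b \<and> (\<forall>c. (\<forall>n. c n \<in> V n) \<longrightarrow> (\<exists>d. (\<forall>n. d n \<in> U n) \<and>
    (\<forall>n\<le>s. \<forall>i<m. \<forall>j<m.
      (a n i = a n j \<longleftrightarrow> b n i = b n j) \<and>
      (a n i \<in> X n (a (Suc n) j) \<longleftrightarrow> b n i \<in> Y n (b (Suc n) j)) \<and>
      (d n = a n i \<longleftrightarrow> c n = b n i) \<and>
      (d n \<in> X n (a (Suc n) i) \<longleftrightarrow> c n \<in> Y n (b (Suc n) i)) \<and>
      (a n i \<in> X n (d (Suc n)) \<longleftrightarrow> b n i \<in> Y n (c (Suc n))) \<and>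
      (d n \<in> X n (d (Suc n)) \<longleftrightarrow> c n \<in> Y n (c (Suc n))))))"
proof -
  interpret M: rich U X by fact
  interpret N: rich V Y by fact
  obtain b where b: "valuation V b" and
    same: "\<And>n l. n \<le> Suc s \<Longrightarrow> same_card_upto 1 {x \<in> U n. colour U X a m n x = l} {y \<in> V n. colour V Y b m n y = l}"
    using copy_parameters[OF assms, of "Suc s" 1 m] by blast
  let ?K = "colour U X a m" and ?L = "colour V Y b m"
  have same_ex: "(\<exists>x\<in>U n. ?K n x = l) \<longleftrightarrow> (\<exists>y\<in>V n. ?L n y = l)" if "n \<le> Suc s" for n l
    using same_card_upto_empty[OF same[OF that, of l]] by auto
  note par = same_colour_parameter[OF assms b]
  have aU: "a n i \<in> U n" and bV: "b n i \<in> V n" for n i using assms(3) b by (auto simp: valuation_def)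
  \<comment> \<open>The colour of \<open>a n i\<close> occurs in the second structure, and only \<open>b n i\<close> can have it.\<close>
  have par_colour: "?K n (a n i) = ?L n (b n i)" if n: "n \<le> Suc s" and i: "i < m" for n i
  proof -
    obtain y where y: "y \<in> V n" "?L n y = ?K n (a n i)" using same_ex[OF n] aU by blast
    then have "y = b n i" using par[OF i aU y(1)] by (metis (no_types))
    with y show ?thesis by simp
  qed
  have realise: "\<exists>d. (\<forall>n. d n \<in> U n) \<and> (\<forall>n\<le>Suc s. ?K n (d n) = ?L n (c n)) \<and>
      (\<forall>n\<le>s. d n \<in> X n (d (Suc n)) \<longleftrightarrow> c n \<in> Y n (c (Suc n)))" if c: "\<And>n. c n \<in> V n" for c
  proof -
    have "\<exists>d. (\<forall>n. d n \<in> U n) \<and> (\<forall>n. k \<le> n \<and> n \<le> Suc s \<longrightarrow> ?K n (d n) = ?L n (c n)) \<and>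
      (\<forall>n. k \<le> n \<and> n \<le> s \<longrightarrow> (d n \<in> X n (d (Suc n)) \<longleftrightarrow> c n \<in> Y n (c (Suc n))))" if "k \<le> Suc s" for k
      using that
    proof (induction k rule: inc_induct)
      case base
      obtain x where x: "x \<in> U (Suc s)" "?K (Suc s) x = ?L (Suc s) (c (Suc s))" using same_ex c by blast
      show ?case
        using x aU by (intro exI[of _ "(\<lambda>n. a n 0)(Suc s := x)"]) auto
    next
      case (step k)
      then obtain d where d: "\<And>n. d n \<in> U n" "\<And>n. Suc k \<le> n \<Longrightarrow> n \<le> Suc s \<Longrightarrow> ?K n (d n) = ?L n (c n)"
        "\<And>n. Suc k \<le> n \<Longrightarrow> n \<le> s \<Longrightarrow> d n \<in> X n (d (Suc n)) \<longleftrightarrow> c n \<in> Y n (c (Suc n))" by blast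
      have "?K (Suc k) (d (Suc k)) = ?L (Suc k) (c (Suc k))" using d(2) step.hyps by simp
      note mem = same_colour_members[OF assms(1,2) this]
      have "\<exists>x\<in>U k. ?K k x = ?L k (c k) \<and> (x \<in> X k (d (Suc k)) \<longleftrightarrow> c k \<in> Y k (c (Suc k)))"
      proof (cases "c k \<in> Y k (c (Suc k))")
        case True
        then have "?L k (c k) \<in> ?K k ` X k (d (Suc k))" using mem(1) by auto
        then show ?thesis using True M.ext_subset by fastforce
      next
        case False
        then have "?L k (c k) \<in> ?K k ` (U k - X k (d (Suc k)))" using mem(2) c by auto
        then show ?thesis using False by fastforce
      qed
      then obtain x where x: "x \<in> U k" "?K k x = ?L k (c k)" "x \<in> X k (d (Suc k)) \<longleftrightarrow> c k \<in> Y k (c (Suc k))" by blast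
      have "Suc k \<le> n" if "k \<le> n" "n \<noteq> k" for n using that by simp
      then show ?case using x d by (intro exI[of _ "d(k := x)"]) auto
    qed
    from this[of 0] show ?thesis by simp
  qed
  have match: "(a n i = a n j \<longleftrightarrow> b n i = b n j) \<and>
      (a n i \<in> X n (a (Suc n) j) \<longleftrightarrow> b n i \<in> Y n (b (Suc n) j)) \<and>
      (d n = a n i \<longleftrightarrow> c n = b n i) \<and>
      (d n \<in> X n (a (Suc n) i) \<longleftrightarrow> c n \<in> Y n (b (Suc n) i)) \<and>
      (a n i \<in> X n (d (Suc n)) \<longleftrightarrow> b n i \<in> Y n (c (Suc n)))"
    if c: "\<And>n. c n \<in> V n" and d: "\<And>n. d n \<in> U n" "\<And>n. n \<le> Suc s \<Longrightarrow> ?K n (d n) = ?L n (c n)"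
      and n: "n \<le> s" and i: "i < m" and j: "j < m" for c d n i j
  proof -
    note col = par_colour[of n i] d(2)[of n]
    note mem = same_colour_members(1)[OF assms(1,2) d(2)[of "Suc n"]]
    have "a n i \<in> X n (d (Suc n)) \<longleftrightarrow> b n i \<in> Y n (c (Suc n))"
    proof
      assume "a n i \<in> X n (d (Suc n))"
      then have "?K n (a n i) \<in> ?L n ` Y n (c (Suc n))" using mem n by auto
      then obtain y where "y \<in> Y n (c (Suc n))" "?K n (a n i) = ?L n y" by auto
      then show "b n i \<in> Y n (c (Suc n))" using par[OF i aU] N.ext_subset by blast
    next
      assume "b n i \<in> Y n (c (Suc n))"
      then have "?L n (b n i) \<in> ?K n ` X n (d (Suc n))" using mem n by auto
      then obtain x where "x \<in> X n (d (Suc n))" "?K n x = ?L n (b n i)" by auto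
      then show "a n i \<in> X n (d (Suc n))" using par[OF i _ bV] M.ext_subset by blast
    qed
    then show ?thesis
      using col n i j par[OF j aU bV] par[OF i d(1) c] same_colour_owners[of U X a m n _ V Y b] by auto
  qed
  show ?thesis
  proof (rule exI[of _ b], intro conjI allI impI)
    show "valuation V b" by (rule b)
    fix c assume "\<forall>n. c n \<in> V n"
    then have c: "c n \<in> V n" for n ..
    obtain d where d: "\<forall>n. d n \<in> U n" "\<forall>n\<le>Suc s. ?K n (d n) = ?L n (c n)"
      "\<forall>n\<le>s. d n \<in> X n (d (Suc n)) \<longleftrightarrow> c n \<in> Y n (c (Suc n))"
      using realise[OF c] by (elim exE conjE)
    note match' = match[of c d, OF c spec[OF d(1)] spec[OF d(2), THEN mp]]
    show "\<exists>d. (\<forall>n. d n \<in> U n) \<and>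
      (\<forall>n\<le>s. \<forall>i<m. \<forall>j<m.
        (a n i = a n j \<longleftrightarrow> b n i = b n j) \<and>
        (a n i \<in> X n (a (Suc n) j) \<longleftrightarrow> b n i \<in> Y n (b (Suc n) j)) \<and>
        (d n = a n i \<longleftrightarrow> c n = b n i) \<and>
        (d n \<in> X n (a (Suc n) i) \<longleftrightarrow> c n \<in> Y n (b (Suc n) i)) \<and>
        (a n i \<in> X n (d (Suc n)) \<longleftrightarrow> b n i \<in> Y n (c (Suc n))) \<and>
        (d n \<in> X n (d (Suc n)) \<longleftrightarrow> c n \<in> Y n (c (Suc n))))"
      by (rule exI[of _ d], intro conjI allI impI) (use d match' in blast)+
  qed
qed

section \<open>Models of type theory\<close>

lemma sat_cong:
  "(\<And>n i. (n, i) \<in> fv p \<Longrightarrow> e n i = e' n i) \<Longrightarrow> sat U X e p \<longleftrightarrow> sat U X e' p"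
proof (induction p arbitrary: e e')
  case (Imp p q)
  then show ?case by (metis UnCI fv.simps(4) sat.simps(4))
next
  case (Forall n p)
  have "sat U X (e(n := case_nat x (e n))) p \<longleftrightarrow> sat U X (e'(n := case_nat x (e' n))) p" for x
  proof (rule Forall.IH)
    fix k i assume k: "(k, i) \<in> fv p"
    show "(e(n := case_nat x (e n))) k i = (e'(n := case_nat x (e' n))) k i"
      using Forall.prems[of k "if k = n then i - 1 else i"] k by (auto split: nat.split)
  qed
  then show ?case by simp
qed simp_all

lemma sat_sentence: "sentence p \<Longrightarrow> sat U X e p \<longleftrightarrow> sat U X e' p"
  by (rule sat_cong) (simp add: sentence_def)

lemma sat_rename: "sat U X e (rename r p) \<longleftrightarrow> sat U X (\<lambda>n i. e n (r n i)) p"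
proof (induction p arbitrary: e r)
  case (Forall n p)
  have "(\<lambda>k i. (e(n := case_nat x (e n))) k ((r(n := case_nat 0 (\<lambda>i. Suc (r n i)))) k i))
      = (\<lambda>k i. e k (r k i))(n := case_nat x (\<lambda>i. e n (r n i)))" for x
    by (auto simp: fun_eq_iff split: nat.split)
  then show ?case by (simp only: rename.simps sat.simps Forall.IH)
qed simp_all

lemma sat_shift: "sat U X (e(n := case_nat x (e n))) (shift n p) \<longleftrightarrow> sat U X e p"
  unfolding shift_def sat_rename by (rule sat_cong) simp

lemma valuation_update:
  "valuation U e \<Longrightarrow> (\<And>i. g i \<in> U n) \<Longrightarrow> valuation U (e(n := g))"
  by (simp add: valuation_def)

lemma valuation_push:
  "valuation U e \<Longrightarrow> x \<in> U n \<Longrightarrow> valuation U (e(n := case_nat x (e n)))"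
  by (auto simp: valuation_def split: nat.split)

text \<open>
  Every valuation is an update of another one, by moving its variables down by one and pushing the first
  one back. Hence the comprehension axioms, which are closed, can be used for arbitrary
  parameters.
\<close>

lemma valid_Forall:
  "(\<forall>e. valuation U e \<longrightarrow> sat U X e (Forall n p)) \<longleftrightarrow> (\<forall>e. valuation U e \<longrightarrow> sat U X e p)"
proof
  assume a: "\<forall>e. valuation U e \<longrightarrow> sat U X e (Forall n p)"
  show "\<forall>e. valuation U e \<longrightarrow> sat U X e p"
  proof (intro allI impI)
    fix e assume e: "valuation U e"
    let ?e = "e(n := \<lambda>i. e n (Suc i))"
    have "valuation U ?e" "e n 0 \<in> U n" using e by (auto simp: valuation_def)
    then have "sat U X (?e(n := case_nat (e n 0) (?e n))) p" using a by (simp only: sat.simps)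
    moreover have "?e(n := case_nat (e n 0) (?e n)) = e" by (auto simp: fun_eq_iff split: nat.split)
    ultimately show "sat U X e p" by (simp only:)
  qed
next
  assume "\<forall>e. valuation U e \<longrightarrow> sat U X e p"
  then show "\<forall>e. valuation U e \<longrightarrow> sat U X e (Forall n p)" by (simp only: sat.simps) (blast intro: valuation_push)
qed

lemma valid_Foralls:
  "(\<forall>e. valuation U e \<longrightarrow> sat U X e (Foralls ns p)) \<longleftrightarrow> (\<forall>e. valuation U e \<longrightarrow> sat U X e p)"
  by (induction ns) (simp_all only: foldr.simps comp_apply id_apply valid_Forall)

lemma fv_Foralls: "fv (Foralls ts p) = {(k, i). (k, i + count_list ts k) \<in> fv p}"
proof (induction ts)
  case (Cons t ts)
  then show ?case by (auto simp: add.commute)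
qed simp

text \<open>
  If all types and indices of the free variables are below \<open>m\<close>, then quantifying \<open>m\<close> times over each type below
  \<open>m\<close> binds them all.
\<close>

lemma closure_exists: "\<exists>ts. sentence (Foralls ts p)"
proof -
  obtain m where m: "\<And>k i. (k, i) \<in> fv p \<Longrightarrow> k < m \<and> i < m"
  proof -
    have "finite (fst ` fv p \<union> snd ` fv p)" using finite_fv by simp
    then obtain m where "\<forall>j\<in>fst ` fv p \<union> snd ` fv p. j < m" using finite_nat_set_iff_bounded by blast
    then show thesis by (intro that[of m]) force
  qed
  have "count_list (concat (replicate j [0..<m])) k = j" if "k < m" for j k
    using that by (induction j) (auto simp: count_list_eq_length_filter distinct_length_filter)
  then have "(k, i + count_list (concat (replicate m [0..<m])) k) \<notin> fv p" for k i
    using m by fastforce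
  then have "fv (Foralls (concat (replicate m [0..<m])) p) = {}" unfolding fv_Foralls by blast
  then show ?thesis unfolding sentence_def by blast
qed

lemma sat_is_upair:
  "sat U X e (is_upair n w u v) \<longleftrightarrow> (\<forall>t\<in>U n. t \<in> X n (e (Suc n) w) \<longleftrightarrow> t = e n u \<or> t = e n v)"
  by (simp add: is_upair_def) blast

definition kpair ::
  "(nat \<Rightarrow> 'u set) \<Rightarrow> (nat \<Rightarrow> 'u \<Rightarrow> 'u set) \<Rightarrow> nat \<Rightarrow> 'u \<Rightarrow> 'u \<Rightarrow> 'u \<Rightarrow> bool" where
  "kpair U X n z u v \<longleftrightarrow> (\<forall>w\<in>U (Suc n). w \<in> X (Suc n) z \<longleftrightarrow>
     (\<forall>t\<in>U n. t \<in> X n w \<longleftrightarrow> t = u) \<or> (\<forall>t\<in>U n. t \<in> X n w \<longleftrightarrow> t = u \<or> t = v))"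

lemma sat_is_pair:
  "sat U X e (is_pair n z u v) \<longleftrightarrow> kpair U X n (e (Suc (Suc n)) z) (e n u) (e n v)"
  by (simp add: is_pair_def sat_is_upair kpair_def) blast

lemma sat_pair_in:
  "sat U X e (pair_in n f u v) \<longleftrightarrow>
    (\<exists>z\<in>U (Suc (Suc n)). z \<in> X (Suc (Suc n)) (e (Suc (Suc (Suc n))) f) \<and> kpair U X n z (e n u) (e n v))"
  by (simp add: pair_in_def sat_is_pair)

context set_closed
begin

text \<open>
  Both \<open>{u}\<close> and \<open>{u, v}\<close> are extensions of elements of the structure, so the pair \<open>z\<close> has members with exactly
  these extensions and therefore determines \<open>u\<close> and \<open>v\<close>.
\<close>

lemma kpair_image:
  assumes "kpair U X n z u v" "u \<in> U n" "v \<in> U n"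
  shows "X n ` X (Suc n) z = {{u}, {u, v}}"
proof -
  obtain w1 w2 where w: "w1 \<in> U (Suc n)" "X n w1 = {u}" "w2 \<in> U (Suc n)" "X n w2 = {u} \<union> {v}"
    using internal_Un[of n "{u}" "{v}"] internal_singleton assms(2,3) unfolding internal_def by metis
  have mem: "w \<in> X (Suc n) z \<longleftrightarrow> X n w = {u} \<or> X n w = {u, v}" if "w \<in> U (Suc n)" for w
  proof -
    have "(\<forall>t\<in>U n. t \<in> X n w \<longleftrightarrow> t = u) \<longleftrightarrow> X n w = {u}"
      "(\<forall>t\<in>U n. t \<in> X n w \<longleftrightarrow> t = u \<or> t = v) \<longleftrightarrow> X n w = {u, v}"
      using ext_subset[of n w] assms(2,3) by auto
    then show ?thesis using assms(1) that unfolding kpair_def by metis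
  qed
  have "w1 \<in> X (Suc n) z" "w2 \<in> X (Suc n) z" using mem w by auto
  moreover have "X n w = {u} \<or> X n w = {u, v}" if "w \<in> X (Suc n) z" for w
    using mem that ext_subset by blast
  ultimately show ?thesis using w(2,4) by (auto simp: image_iff)
qed

lemma kpair_inject:
  assumes "kpair U X n z u v" "kpair U X n z u' v'" "u \<in> U n" "v \<in> U n" "u' \<in> U n" "v' \<in> U n"
  shows "u = u' \<and> v = v'"
proof -
  have "{{u}, {u, v}} = {{u'}, {u', v'}}" using kpair_image assms by metis
  then show ?thesis by (auto simp: doubleton_eq_iff)
qed

text \<open>
  The graph \<open>f\<close> induces a genuine map of the extension of \<open>x\<close> to itself, injective and not surjective,
  and a finite set has no such map.
\<close>

lemma infinity_infinite:
  assumes "sat U X e infinity"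
  shows "infinite (U 0)"
proof
  assume fin: "finite (U 0)"
  from assms obtain x f where x: "x \<in> U (Suc 0)" "f \<in> U (Suc (Suc (Suc 0)))"
    and s: "sat U X (e(Suc 0 := case_nat x (e (Suc 0)), Suc (Suc (Suc 0)) := case_nat f (e (Suc (Suc (Suc 0))))))
      (And is_function (And is_injective (Neg is_surjective)))"
    by (auto simp: infinity_def numeral_eq_Suc)
  define P where "P u v \<longleftrightarrow> (\<exists>z\<in>U (Suc (Suc 0)). z \<in> X (Suc (Suc 0)) f \<and> kpair U X 0 z u v)" for u v
  have pairs: "\<exists>u\<in>U 0. \<exists>v\<in>U 0. u \<in> X 0 x \<and> v \<in> X 0 x \<and> kpair U X 0 z u v"
    if "z \<in> U (Suc (Suc 0))" "z \<in> X (Suc (Suc 0)) f" for z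
    using s that by (auto simp: is_function_def sat_is_pair numeral_eq_Suc)
  have total: "\<exists>v\<in>U 0. P u v" if "u \<in> X 0 x" "u \<in> U 0" for u
    using s that by (auto simp: is_function_def sat_pair_in P_def numeral_eq_Suc)
  have inj: "u = u'" if "P u v" "P u' v" "u \<in> U 0" "u' \<in> U 0" "v \<in> U 0" for u u' v
    using s that by (auto simp: is_injective_def sat_pair_in P_def numeral_eq_Suc)
  have nsurj: "\<exists>v\<in>U 0. v \<in> X 0 x \<and> (\<forall>u\<in>U 0. \<not> P u v)"
    using s by (auto simp: is_surjective_def sat_pair_in P_def numeral_eq_Suc)
  have range: "v \<in> X 0 x" if "P u v" "u \<in> U 0" "v \<in> U 0" for u v
    using that pairs kpair_inject unfolding P_def by metis
  obtain g where g: "\<And>u. u \<in> X 0 x \<Longrightarrow> g u \<in> U 0 \<and> P u (g u)"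
    using total ext_subset by (metis subsetD)
  have "g ` X 0 x \<subseteq> X 0 x" using g range ext_subset by blast
  moreover have "inj_on g (X 0 x)"
  proof (rule inj_onI)
    fix u u' assume u: "u \<in> X 0 x" "u' \<in> X 0 x" "g u = g u'"
    then have "u \<in> U 0" "u' \<in> U 0" using ext_subset by auto
    then show "u = u'" using g[OF u(1)] g[OF u(2)] u(3) inj[of u "g u" u'] by simp
  qed
  moreover have "finite (X 0 x)" using fin ext_subset finite_subset by blast
  ultimately have "g ` X 0 x = X 0 x" by (simp add: endo_inj_surj)
  moreover obtain v where v: "v \<in> X 0 x" "\<forall>u\<in>U 0. \<not> P u v" using nsurj by blast
  ultimately obtain u where "u \<in> X 0 x" "v = g u" by blast
  then show False using g v(2) ext_subset by blast
qed

end

lemma sat_comprehension: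
  "sat U X e (comprehension n p) \<longleftrightarrow>
    (\<exists>y\<in>U (Suc n). \<forall>x\<in>U n. x \<in> X n y \<longleftrightarrow> sat U X (e(n := case_nat x (e n))) p)"
proof -
  have "sat U X (e(Suc n := case_nat y (e (Suc n)), n := case_nat x (e n))) (shift (Suc n) p)
      \<longleftrightarrow> sat U X (e(n := case_nat x (e n))) p" for x y
    using sat_shift[of U X "e(n := case_nat x (e n))" "Suc n" y p] by (simp add: fun_upd_twist)
  then show ?thesis by (simp add: comprehension_def) blast
qed

theorem TSTI_model_rich:
  assumes e: "valuation U e" and sub: "\<And>n y. X n y \<subseteq> U n" and model: "\<And>p. p \<in> TSTI \<Longrightarrow> sat U X e p"
  shows "rich U X"
proof -
  have compr: "internal U X n {x \<in> U n. sat U X (e'(n := case_nat x (e' n))) p}" if "valuation U e'" for n p e'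
  proof -
    obtain ts where ts: "sentence (Foralls ts (comprehension n p))" using closure_exists by blast
    then have "Foralls ts (comprehension n p) \<in> TSTI" unfolding TSTI_def TST_def by blast
    then have "\<forall>e. valuation U e \<longrightarrow> sat U X e (Foralls ts (comprehension n p))"
      using model sat_sentence[OF ts] by blast
    then have "sat U X e' (comprehension n p)" using that unfolding valid_Foralls by blast
    then obtain y where "y \<in> U (Suc n)" "\<forall>x\<in>U n. x \<in> X n y \<longleftrightarrow> sat U X (e'(n := case_nat x (e' n))) p"
      unfolding sat_comprehension by blast
    then show ?thesis using sub unfolding internal_def by blast
  qed
  interpret set_closed U X
  proof
    show "X n y \<subseteq> U n" for n y by (rule sub)
  next
    fix x n y assume xy: "x \<in> U (Suc n)" "y \<in> U (Suc n)" "X n x = X n y"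
    have "extensionality n \<in> TSTI" by (auto simp: TSTI_def TST_def)
    from model[OF this] have "\<forall>x\<in>U (Suc n). \<forall>y\<in>U (Suc n). (\<forall>z\<in>U n. z \<in> X n x \<longleftrightarrow> z \<in> X n y) \<longrightarrow> x = y"
      by (simp add: extensionality_def) blast
    with xy show "x = y" by blast
  next
    fix x n assume "x \<in> U n"
    with e have "valuation U (e(n := \<lambda>_. x))" by (auto intro: valuation_update)
    from compr[OF this, of n "Equ n 0 1"] \<open>x \<in> U n\<close> show "internal U X n {x}"
      by (simp add: Collect_conv_if conj_commute)
  next
    fix n A assume "internal U X n A"
    then obtain y where y: "y \<in> U (Suc n)" "X n y = A" by (auto simp: internal_def)
    with e have "valuation U (e(Suc n := \<lambda>_. y))" by (auto intro: valuation_update)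
    from compr[OF this, of n "Neg (Mem n 0 0)"] y show "internal U X n (U n - A)"
      by (simp add: set_diff_eq)
  next
    fix n A B assume "internal U X n A" "internal U X n B"
    then obtain y z where y: "y \<in> U (Suc n)" "X n y = A" "z \<in> U (Suc n)" "X n z = B" by (auto simp: internal_def)
    with e have v: "valuation U (e(Suc n := \<lambda>i. if i = 0 then y else z))" by (auto intro: valuation_update)
    have "A \<union> B = {x \<in> U n. x \<notin> A \<longrightarrow> x \<in> B}" using y sub by blast
    with compr[OF v, of n "Or (Mem n 0 0) (Mem n 0 1)"] y show "internal U X n (A \<union> B)" by simp
  next
    fix n A assume "internal U X n A"
    then obtain y where y: "y \<in> U (Suc n)" "X n y = A" by (auto simp: internal_def)
    with e have v: "valuation U (e(Suc n := \<lambda>_. y))" by (auto intro: valuation_update)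
    have "{x \<in> U (Suc n). X n x \<inter> A \<noteq> {}} = {x \<in> U (Suc n). \<exists>z\<in>U n. z \<in> X n x \<and> z \<in> A}" using y sub by blast
    with compr[OF v, of "Suc n" "Exists n (And (Mem n 0 0) (Mem n 0 1))"] y
    show "internal U X (Suc n) {x \<in> U (Suc n). X n x \<inter> A \<noteq> {}}" by simp
  next
    fix n A assume "internal U X n A"
    then obtain y where y: "y \<in> U (Suc n)" "X n y = A" by (auto simp: internal_def)
    with e have v: "valuation U (e(Suc n := \<lambda>_. y))" by (auto intro: valuation_update)
    have "{x \<in> U (Suc n). A - X n x \<noteq> {}} = {x \<in> U (Suc n). \<exists>z\<in>U n. z \<in> A \<and> z \<notin> X n x}" using y sub by blast
    with compr[OF v, of "Suc n" "Exists n (And (Mem n 0 1) (Neg (Mem n 0 0)))"] y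
    show "internal U X (Suc n) {x \<in> U (Suc n). A - X n x \<noteq> {}}" by simp
  qed
  have "infinity \<in> TSTI" by (simp add: TSTI_def)
  from infinity_infinite[OF model[OF this]] show ?thesis by unfold_locales
qed

lemma TSTI_sentences: "p \<in> TSTI \<Longrightarrow> sentence p"
proof -
  have "sentence (extensionality n)" for n
    by (auto simp: sentence_def extensionality_def)
  moreover have "sentence infinity"
    by (auto simp: sentence_def infinity_def is_function_def is_injective_def is_surjective_def
        pair_in_def is_pair_def is_upair_def split: if_splits)
  ultimately show "p \<in> TSTI \<Longrightarrow> sentence p" by (auto simp: TSTI_def TST_def)
qed

section \<open>Transfer of counterexamples\<close>

text \<open>
  As the types are distinct, the quantifiers do not shift each other's variables: each binds the variable 0 of
  its type, so the choice of all values together amounts to one function on types.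
\<close>

lemma sat_Existss:
  assumes "distinct ss"
  shows "sat U X e (Existss ss p) \<longleftrightarrow>
    (\<exists>c. (\<forall>n\<in>set ss. c n \<in> U n) \<and> sat U X (\<lambda>n. if n \<in> set ss then case_nat (c n) (e n) else e n) p)"
  using assms
proof (induction ss arbitrary: e)
  case Nil then show ?case by simp
next
  case (Cons s ss)
  have upd: "(\<lambda>n. if n \<in> set ss then case_nat (c n) ((e(s := case_nat x (e s))) n) else (e(s := case_nat x (e s))) n)
     = (\<lambda>n. if n \<in> set (s # ss) then case_nat ((c(s := x)) n) (e n) else e n)" for c x
    using Cons.prems by (auto simp: fun_eq_iff split: nat.split)
  have "sat U X e (Existss (s # ss) p) \<longleftrightarrow> (\<exists>x\<in>U s. sat U X (e(s := case_nat x (e s))) (Existss ss p))" by simp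
  also have "\<dots> \<longleftrightarrow> (\<exists>x\<in>U s. \<exists>c. (\<forall>n\<in>set ss. c n \<in> U n) \<and>
      sat U X (\<lambda>n. if n \<in> set (s # ss) then case_nat ((c(s := x)) n) (e n) else e n) p)"
    using Cons.prems by (simp only: Cons.IH upd distinct.simps)
  also have "\<dots> \<longleftrightarrow> (\<exists>c. (\<forall>n\<in>set (s # ss). c n \<in> U n) \<and>
      sat U X (\<lambda>n. if n \<in> set (s # ss) then case_nat (c n) (e n) else e n) p)" (is "?L \<longleftrightarrow> ?R")
  proof
    assume ?L
    then obtain x c where "x \<in> U s" "\<forall>n\<in>set ss. c n \<in> U n"
      "sat U X (\<lambda>n. if n \<in> set (s # ss) then case_nat ((c(s := x)) n) (e n) else e n) p" by blast
    then show ?R by (intro exI[of _ "c(s := x)"]) auto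
  next
    assume ?R
    then obtain c where c: "\<forall>n\<in>set (s # ss). c n \<in> U n"
      "sat U X (\<lambda>n. if n \<in> set (s # ss) then case_nat (c n) (e n) else e n) p" by blast
    show ?L
    proof (intro bexI[of _ "c s"] exI[of _ c] conjI)
      show "sat U X (\<lambda>n. if n \<in> set (s # ss) then case_nat ((c(s := c s)) n) (e n) else e n) p"
        using c(2) by (simp only: fun_upd_triv)
    qed (use c(1) in simp_all)
  qed
  finally show ?case .
qed

lemma qfree_sat_cong:
  assumes "qfree p"
    and "\<And>n i j. (n, i) \<in> fv p \<Longrightarrow> (n, j) \<in> fv p \<Longrightarrow> e n i = e n j \<longleftrightarrow> e' n i = e' n j"
    and "\<And>n i j. (n, i) \<in> fv p \<Longrightarrow> (Suc n, j) \<in> fv p \<Longrightarrow> e n i \<in> X n (e (Suc n) j) \<longleftrightarrow> e' n i \<in> Y n (e' (Suc n) j)"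
  shows "sat U X e p \<longleftrightarrow> sat V Y e' p"
  using assms
proof (induction p)
  case (Imp p q)
  from Imp.prems have "qfree p" "qfree q" by auto
  moreover have "sat U X e p \<longleftrightarrow> sat V Y e' p" using \<open>qfree p\<close> Imp.prems(2,3) by (intro Imp.IH) auto
  moreover have "sat U X e q \<longleftrightarrow> sat V Y e' q" using \<open>qfree q\<close> Imp.prems(2,3) by (intro Imp.IH) auto
  ultimately show ?case by simp
qed simp_all

text \<open>
  Any values in the second structure that verify \<open>\<theta>\<close> over the copied parameters are matched by values in the first
  structure, which verify \<open>\<theta>\<close> over \<open>a\<close> because the atomic formulae agree.
\<close>

lemma transfer_counterexample:
  assumes "rich U X" "rich V Y" "valuation U a" "\<not> sat U X a (Existss ss \<theta>)" "distinct ss" "qfree \<theta>"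
  shows "\<exists>b. valuation V b \<and> \<not> sat V Y b (Existss ss \<theta>)"
proof -
  obtain m where m: "\<And>k i. (k, i) \<in> fv \<theta> \<Longrightarrow> k < m \<and> i < m"
  proof -
    have "finite (fst ` fv \<theta> \<union> snd ` fv \<theta>)" using finite_fv by simp
    then obtain m where "\<forall>j\<in>fst ` fv \<theta> \<union> snd ` fv \<theta>. j < m" using finite_nat_set_iff_bounded by blast
    then show thesis by (intro that[of m]) force
  qed
  from realise_over_copy[OF assms(1-3), of m m]
  obtain b where b: "valuation V b" and real: "\<forall>c. (\<forall>n. c n \<in> V n) \<longrightarrow> (\<exists>d. (\<forall>n. d n \<in> U n) \<and>
    (\<forall>n\<le>m. \<forall>i<m. \<forall>j<m.
      (a n i = a n j \<longleftrightarrow> b n i = b n j) \<and>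
      (a n i \<in> X n (a (Suc n) j) \<longleftrightarrow> b n i \<in> Y n (b (Suc n) j)) \<and>
      (d n = a n i \<longleftrightarrow> c n = b n i) \<and>
      (d n \<in> X n (a (Suc n) i) \<longleftrightarrow> c n \<in> Y n (b (Suc n) i)) \<and>
      (a n i \<in> X n (d (Suc n)) \<longleftrightarrow> b n i \<in> Y n (c (Suc n))) \<and>
      (d n \<in> X n (d (Suc n)) \<longleftrightarrow> c n \<in> Y n (c (Suc n)))))"
    by (elim exE conjE) (rule that)
  have "\<not> sat V Y b (Existss ss \<theta>)"
  proof
    assume "sat V Y b (Existss ss \<theta>)"
    then obtain c where c: "\<forall>n\<in>set ss. c n \<in> V n"
      "sat V Y (\<lambda>n. if n \<in> set ss then case_nat (c n) (b n) else b n) \<theta>"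
      unfolding sat_Existss[OF assms(5)] by blast
    \<comment> \<open>Types over which no existential quantifier ranges get an arbitrary element.\<close>
    define c' where "c' n = (if n \<in> set ss then c n else b n 0)" for n
    have "\<forall>n. c' n \<in> V n" using c(1) b by (auto simp: c'_def valuation_def)
    from real[rule_format, OF this[rule_format]] obtain d where d: "\<forall>n. d n \<in> U n" and
      atoms: "\<And>n i j. n \<le> m \<Longrightarrow> i < m \<Longrightarrow> j < m \<Longrightarrow>
      (a n i = a n j \<longleftrightarrow> b n i = b n j) \<and>
      (a n i \<in> X n (a (Suc n) j) \<longleftrightarrow> b n i \<in> Y n (b (Suc n) j)) \<and>
      (d n = a n i \<longleftrightarrow> c' n = b n i) \<and>
      (d n \<in> X n (a (Suc n) i) \<longleftrightarrow> c' n \<in> Y n (b (Suc n) i)) \<and>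
      (a n i \<in> X n (d (Suc n)) \<longleftrightarrow> b n i \<in> Y n (c' (Suc n))) \<and>
      (d n \<in> X n (d (Suc n)) \<longleftrightarrow> c' n \<in> Y n (c' (Suc n)))" by blast
    have aa: "a n i = a n j \<longleftrightarrow> b n i = b n j" "a n i \<in> X n (a (Suc n) j) \<longleftrightarrow> b n i \<in> Y n (b (Suc n) j)"
      if "n \<le> m" "i < m" "j < m" for n i j using atoms[OF that] by blast+
    have da: "d n = a n i \<longleftrightarrow> c' n = b n i" "a n i = d n \<longleftrightarrow> b n i = c' n"
      "d n \<in> X n (a (Suc n) i) \<longleftrightarrow> c' n \<in> Y n (b (Suc n) i)"
      "a n i \<in> X n (d (Suc n)) \<longleftrightarrow> b n i \<in> Y n (c' (Suc n))"
      "d n \<in> X n (d (Suc n)) \<longleftrightarrow> c' n \<in> Y n (c' (Suc n))"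
      if "n \<le> m" "i < m" for n i using atoms[OF that that(2)] by (simp_all add: eq_commute)
    define e where "e n = (if n \<in> set ss then case_nat (d n) (a n) else a n)" for n
    define f where "f n = (if n \<in> set ss then case_nat (c n) (b n) else b n)" for n
    have cases: "(e n i = d n \<and> f n i = c' n) \<or> (\<exists>i'<m. e n i = a n i' \<and> f n i = b n i')"
      if "i < m" for n i
    proof (cases "n \<in> set ss")
      case True
      then show ?thesis
        using that by (cases i) (auto simp: e_def f_def c'_def intro: exI[of _ "i - 1"])
    qed (use that in \<open>auto simp: e_def f_def\<close>)
    have "sat U X e \<theta> \<longleftrightarrow> sat V Y f \<theta>"
    proof (rule qfree_sat_cong[OF assms(6)])
      fix n i j assume "(n, i) \<in> fv \<theta>" "(n, j) \<in> fv \<theta>"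
      then have "n \<le> m" "i < m" "j < m" using m by force+
      then show "e n i = e n j \<longleftrightarrow> f n i = f n j"
        using cases[OF \<open>i < m\<close>, of n] cases[OF \<open>j < m\<close>, of n]
        by (elim disjE exE conjE) (simp_all add: aa da)
    next
      fix n i j assume "(n, i) \<in> fv \<theta>" "(Suc n, j) \<in> fv \<theta>"
      then have "n \<le> m" "i < m" "j < m" using m by force+
      then show "e n i \<in> X n (e (Suc n) j) \<longleftrightarrow> f n i \<in> Y n (f (Suc n) j)"
        using cases[OF \<open>i < m\<close>, of n] cases[OF \<open>j < m\<close>, of "Suc n"]
        by (elim disjE exE conjE) (simp_all add: aa da)
    qed
    with c(2) have "sat U X e \<theta>" by (simp only: f_def[abs_def])
    then have "sat U X a (Existss ss \<theta>)"
      unfolding sat_Existss[OF assms(5)] e_def[abs_def] using d by blast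
    with assms(4) show False ..
  qed
  with b show ?thesis by blast
qed

theorem corollary4p18:
  fixes rs ss :: "nat list" and \<theta> \<phi> :: fm
  assumes "\<phi> = Foralls rs (Existss ss \<theta>)"
    and "sentence \<phi>"
    and "sorted_wrt (>) ss"
    and "qfree \<theta>"
  shows "decides TSTI \<phi>"
proof (rule ccontr)
  assume "\<not> decides TSTI \<phi>"
  then have "\<not> insert (Neg \<phi>) TSTI \<turnstile> Falsum" "\<not> insert \<phi> TSTI \<turnstile> Falsum"
    unfolding decides_def by (meson derives.Contr derives.ImpI)+
  have "sentence (Neg \<phi>)" using assms(2) by (simp add: sentence_def)
  obtain U :: "nat \<Rightarrow> nat set" and X e where M: "\<And>n y. X n y \<subseteq> U n" "valuation U e"
    "\<And>p. p \<in> insert (Neg \<phi>) TSTI \<Longrightarrow> sat U X e p"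
    using model_existence[OF _ \<open>\<not> insert (Neg \<phi>) TSTI \<turnstile> Falsum\<close>] TSTI_sentences \<open>sentence (Neg \<phi>)\<close> by (metis insertE)
  obtain V :: "nat \<Rightarrow> nat set" and Y f where N: "\<And>n y. Y n y \<subseteq> V n" "valuation V f"
    "\<And>p. p \<in> insert \<phi> TSTI \<Longrightarrow> sat V Y f p"
    using model_existence[OF _ \<open>\<not> insert \<phi> TSTI \<turnstile> Falsum\<close>] TSTI_sentences assms(2) by (metis insertE)
  have rich: "rich U X" "rich V Y" using TSTI_model_rich M N by blast+
  have "distinct ss" using assms(3) by (induction ss) auto
  have "\<not> sat U X e \<phi>" using M(3)[of "Neg \<phi>"] by simp
  then have "\<not> (\<forall>a. valuation U a \<longrightarrow> sat U X a (Existss ss \<theta>))"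
    using valid_Foralls[of U X rs "Existss ss \<theta>"] M(2) assms(1) by blast
  then obtain a where "valuation U a" "\<not> sat U X a (Existss ss \<theta>)" by blast
  then obtain b where "valuation V b" "\<not> sat V Y b (Existss ss \<theta>)"
    using transfer_counterexample[OF rich] \<open>distinct ss\<close> assms(4) by blast
  then have "\<exists>b. valuation V b \<and> \<not> sat V Y b \<phi>"
    using valid_Foralls[of V Y rs "Existss ss \<theta>"] assms(1) by blast
  with N(3)[of \<phi>] sat_sentence[OF assms(2)] show False by blast
qed

end
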